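(* Let $X$ be a compact Hausdorff space and $E$ be a Banach lattice with order continuous norm. Then for every comonotonic additive operator $I:C(X)\rightarrow E$ with bounded variation there exists a unique upper continuous set function $\boldsymbol{\mu}:\Sigma_{up}^{+}(X)\rightarrow E$ with bounded variation such that $$I(f)=\int_{0}^{+\infty}\boldsymbol{\mu}(\{x:f(x)\geq t\})\,\mathrm{d}t+\int_{-\infty}^{0}\left[\boldsymbol{\mu}(\{x:f(x)\geq t\})-\boldsymbol{\mu}(X)\right]\mathrm{d}t$$ for all $f\in C(X)$ (the integrals being Bochner integrals with respect to Lebesgue measure).
   Context: $C(X)$ is the Banach lattice of real-valued continuous functions on $X$ with pointwise order and sup norm. Operators $I:C(X)\to E$ are not assumed linear. $I$ is comonotonic additive if $I(f+g)=I(f)+I(g)$ whenever $f,g$ are comonotone, i.e. $(f(s)-f(t))(g(s)-g(t))\geq0$ for all $s,t\in X$. A Banach lattice has order continuous norm if every monotone order bounded sequence is norm convergent. $I$ has bounded variation if for all $f\leq g$ in $C(X)$ the supremum $$\vee_{f}^{g}I=\sup\sum_{k=1}^{n}|I(f_{k})-I(f_{k-1})|$$ exists in $E$, the supremum being taken over all finite chains $f=f_{0}\leq f_{1}\leq\cdots\leq f_{n}=g$ in $C(X)$ (here $|\cdot|$ is the modulus in $E$). $\Sigma_{up}^{+}(X)$ is the lattice of all sets of the form $\{x\in X:f(x)\geq t\}$ with $f\in C(X)$, $t\in\mathbb{R}$. A set function $\boldsymbol{\mu}:\Sigma\to E$ on a lattice of sets $\Sigma$ has bounded variation if $\boldsymbol{\mu}(\emptyset)=0$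 and $$|\boldsymbol{\mu}|(X)=\sup\sum_{k=1}^{n}|\boldsymbol{\mu}(A_{k})-\boldsymbol{\mu}(A_{k-1})|$$ exists in $E$, the supremum being taken over all finite chains $\emptyset=A_{0}\subset A_{1}\subset\cdots\subset A_{n}\subset X$ of sets in $\Sigma$. It is upper continuous if $\lim_n\boldsymbol{\mu}(A_n)=\boldsymbol{\mu}(\bigcap_n A_n)$ (norm limit) for every nonincreasing sequence $(A_n)$ in $\Sigma$ with $\bigcap_nA_n\in\Sigma$. *)

theory Defs
  imports
    "HOL-Analysis.Analysis"
    "HOL-Library.Lattice_Algebras"
    "HOL-Library.Lub_Glb"
begin

class banach_lattice = banach + ordered_real_vector + lattice_ab_group_add_abs +
  assumes norm_le_norm_of_abs_le_abs: "\<bar>x\<bar> \<le> \<bar>y\<bar> \<Longrightarrow> norm x \<le> norm y"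

class order_continuous_banach_lattice = banach_lattice +
  assumes monotone_order_bounded_convergent:
    "(\<forall>m. \<forall>n\<ge>m. u m \<le> u n) \<or> (\<forall>m. \<forall>n\<ge>m. u n \<le> u m) \<Longrightarrow>
      bdd_below (range u) \<Longrightarrow> bdd_above (range u) \<Longrightarrow> convergent u"

text \<open>
  The space $C(X)$ for a topology \<open>X\<close>. Continuous functions on the carrier of \<open>X\<close> are extended
  by zero outside of it, so that each of them is represented exactly once and the pointwise
  operations and the pointwise order of the function type are those of $C(X)$.
\<close>

definition cont_space :: "'x topology \<Rightarrow> ('x \<Rightarrow> real) set" where
  "cont_space X = {f. continuous_map X euclideanreal f \<and> (\<forall>x. x \<notin> topspace X \<longrightarrow> f x = 0)}"

definition comonotone :: "'x topology \<Rightarrow> ('x \<Rightarrow> real) \<Rightarrow> ('x \<Rightarrow> real) \<Rightarrow> bool" where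
  "comonotone X f g \<longleftrightarrow>
    (\<forall>s\<in>topspace X. \<forall>t\<in>topspace X. (f s - f t) * (g s - g t) \<ge> 0)"

definition comonotonic_additive ::
    "'x topology \<Rightarrow> (('x \<Rightarrow> real) \<Rightarrow> 'e::banach_lattice) \<Rightarrow> bool" where
  "comonotonic_additive X I \<longleftrightarrow>
    (\<forall>f\<in>cont_space X. \<forall>g\<in>cont_space X.
      comonotone X f g \<longrightarrow> I (\<lambda>x. f x + g x) = I f + I g)"

definition operator_variation_sums ::
    "'x topology \<Rightarrow> (('x \<Rightarrow> real) \<Rightarrow> 'e::banach_lattice) \<Rightarrow> ('x \<Rightarrow> real) \<Rightarrow> ('x \<Rightarrow> real) \<Rightarrow> 'e set"
where
  "operator_variation_sums X I f g =
    {(\<Sum>k=1..n::nat. \<bar>I (h k) - I (h (k - 1))\<bar>) | h n.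
      (\<forall>k\<le>n. h k \<in> cont_space X) \<and> h 0 = f \<and> h n = g \<and> (\<forall>k\<in>{1..n}. h (k - 1) \<le> h k)}"

definition operator_bounded_variation ::
    "'x topology \<Rightarrow> (('x \<Rightarrow> real) \<Rightarrow> 'e::banach_lattice) \<Rightarrow> bool" where
  "operator_bounded_variation X I \<longleftrightarrow>
    (\<forall>f\<in>cont_space X. \<forall>g\<in>cont_space X. f \<le> g \<longrightarrow>
      (\<exists>v. isLub UNIV (operator_variation_sums X I f g) v))"

definition upper_sets :: "'x topology \<Rightarrow> 'x set set" where
  "upper_sets X = {{x \<in> topspace X. f x \<ge> t} | f t. f \<in> cont_space X}"

definition set_variation_sums :: "'x set set \<Rightarrow> ('x set \<Rightarrow> 'e::banach_lattice) \<Rightarrow> 'e set" where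
  "set_variation_sums \<Sigma> \<mu> =
    {(\<Sum>k=1..n::nat. \<bar>\<mu> (A k) - \<mu> (A (k - 1))\<bar>) | A n.
      (\<forall>k\<le>n. A k \<in> \<Sigma>) \<and> A 0 = {} \<and> (\<forall>k\<in>{1..n}. A (k - 1) \<subseteq> A k)}"

definition set_bounded_variation :: "'x set set \<Rightarrow> ('x set \<Rightarrow> 'e::banach_lattice) \<Rightarrow> bool" where
  "set_bounded_variation \<Sigma> \<mu> \<longleftrightarrow>
    \<mu> {} = 0 \<and> (\<exists>v. isLub UNIV (set_variation_sums \<Sigma> \<mu>) v)"

definition upper_continuous :: "'x set set \<Rightarrow> ('x set \<Rightarrow> 'e::banach_lattice) \<Rightarrow> bool" where
  "upper_continuous \<Sigma> \<mu> \<longleftrightarrow>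
    (\<forall>A. range A \<subseteq> \<Sigma> \<longrightarrow> decseq A \<longrightarrow> (\<Inter>n. A n) \<in> \<Sigma> \<longrightarrow>
      (\<lambda>n. \<mu> (A n)) \<longlonglongrightarrow> \<mu> (\<Inter>n. A n))"

text \<open>
  \<^const>\<open>has_bochner_integral\<close> is restricted to second countable (that is, separable) value
  spaces. The definition below has no such restriction: Borel measurability is replaced by strong
  measurability, that is, being an almost everywhere limit of simple functions.
\<close>

definition strongly_measurable :: "'a measure \<Rightarrow> ('a \<Rightarrow> 'e::banach) \<Rightarrow> bool" where
  "strongly_measurable M f \<longleftrightarrow>
    (\<exists>s. (\<forall>i. simple_function M (s i)) \<and> (AE x in M. (\<lambda>i. s i x) \<longlonglongrightarrow> f x))"

definition has_strong_bochner_integral :: "'a measure \<Rightarrow> ('a \<Rightarrow> 'e::banach) \<Rightarrow> 'e \<Rightarrow> bool" where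
  "has_strong_bochner_integral M f v \<longleftrightarrow>
    strongly_measurable M f \<and>
    (\<exists>s. (\<forall>i. Bochner_Integration.simple_bochner_integrable M (s i)) \<and>
      (\<lambda>i. \<integral>\<^sup>+x. norm (f x - s i x) \<partial>M) \<longlonglongrightarrow> 0 \<and>
      (\<lambda>i. Bochner_Integration.simple_bochner_integral M (s i)) \<longlonglongrightarrow> v)"

end

theory Submission
  imports Defs
begin

text \<open>
  For a closed set \<open>A\<close> the functions \<open>0 \<le> u \<le> 1\<close> equal to \<open>1\<close> near \<open>A\<close> form a downward directed family.
  Bounded variation of \<open>I\<close> and order continuity of the norm force \<open>I u\<close> to converge along it, and
  \<open>\<mu> A\<close> is the limit; compactness of \<open>X\<close> gives upper continuity.

  Comonotonic additivity applied to the layers of \<open>f\<close> shows that \<open>\<Phi> s = I (min f s)\<close> satisfies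
  \<open>\<Phi> b - \<Phi> a = (b - a) I (ramp a b f)\<close>, where \<open>ramp a b f\<close> rises from \<open>0\<close> on \<open>{f \<le> a}\<close> to \<open>1\<close> on
  \<open>{f \<ge> b}\<close>. Hence \<open>F t = \<mu> {f \<ge> t}\<close> is the left derivative of \<open>\<Phi>\<close>, and the difference quotients of
  \<open>\<Phi>\<close> also converge from the right. A subdivision argument then approximates \<open>F\<close>
  uniformly by step functions whose integrals approximate the increments of \<open>\<Phi>\<close>, which yields the
  integral formula. Conversely, the formula for the ramps together with the left continuity of
  \<open>t \<mapsto> \<mu> {f \<ge> t}\<close> recovers \<open>\<mu> {f \<ge> t}\<close> as a limit of values of \<open>I\<close>, so \<open>\<mu>\<close> is unique.
\<close>

section \<open>Banach lattices with order continuous norm\<close>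

lemma norm_abs_eq: "norm \<bar>x\<bar> = norm (x::'e::banach_lattice)"
  by (intro antisym norm_le_norm_of_abs_le_abs) simp_all

lemma norm_mono_nonneg:
  fixes x y :: "'e::banach_lattice"
  assumes "0 \<le> x" "x \<le> y"
  shows "norm x \<le> norm y"
  by (rule norm_le_norm_of_abs_le_abs) (use assms in simp)

lemma norm_le_of_abs_le:
  fixes x y :: "'e::banach_lattice"
  assumes "\<bar>x\<bar> \<le> y"
  shows "norm x \<le> norm y"
  using norm_mono_nonneg[OF abs_ge_zero assms] by (simp add: norm_abs_eq)

text \<open>The negative part of \<open>l\<close> is dominated by
  \<open>\<bar>x n - l\<bar>\<close>, whose norm tends to 0, so the positive cone is closed under
  norm limits.\<close>

lemma nonneg_of_tendsto:
  fixes x :: "nat \<Rightarrow> 'e::banach_lattice"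
  assumes lim: "x \<longlonglongrightarrow> l" and nonneg: "\<And>n. 0 \<le> x n"
  shows "0 \<le> l"
proof -
  have "norm (nprt l) \<le> norm (x n - l)" for n
  proof -
    have "- l \<le> \<bar>x n - l\<bar>"
    proof -
      have "- l \<le> x n - l" using nonneg[of n] by simp
      also have "\<dots> \<le> \<bar>x n - l\<bar>" by (rule abs_ge_self)
      finally show ?thesis .
    qed
    then have "pprt (- l) \<le> \<bar>x n - l\<bar>" by (simp add: pprt_def)
    then have "norm (pprt (- l)) \<le> norm \<bar>x n - l\<bar>" by (intro norm_mono_nonneg) simp_all
    then show ?thesis by (simp add: pprt_neg norm_abs_eq)
  qed
  moreover have "(\<lambda>n. norm (x n - l)) \<longlonglongrightarrow> 0"
    using lim by (simp add: LIM_zero tendsto_norm_zero)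
  ultimately have "norm (nprt l) \<le> 0"
    by (intro LIMSEQ_le_const) auto
  then show ?thesis by (simp add: zero_le_iff_zero_nprt)
qed

lemma const_le_tendsto_banach_lattice:
  fixes x :: "nat \<Rightarrow> 'e::banach_lattice"
  assumes "x \<longlonglongrightarrow> l" "\<And>n. v \<le> x n"
  shows "v \<le> l"
  using nonneg_of_tendsto[OF tendsto_diff[OF assms(1) tendsto_const], of v] assms(2) by simp

text \<open>Closedness of the positive cone, in the form used for order inequalities that are only
  known up to an error of small norm. The error vector may have any sign.\<close>

lemma le_of_norm_error:
  fixes x v :: "'e::banach_lattice"
  assumes "\<And>\<epsilon>. \<epsilon> > 0 \<Longrightarrow> \<exists>e. norm e \<le> \<epsilon> \<and> x \<le> v + e"
  shows "x \<le> v"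
proof -
  have "\<exists>e. norm e \<le> inverse (real (Suc n)) \<and> x \<le> v + e" for n
    using assms by simp
  then obtain e where e: "\<And>n. norm (e n) \<le> inverse (real (Suc n))" "\<And>n. x \<le> v + e n"
    by metis
  have "e \<longlonglongrightarrow> 0"
    by (rule Lim_null_comparison[OF _ LIMSEQ_inverse_real_of_nat]) (use e in auto)
  then have "(\<lambda>n. v + e n) \<longlonglongrightarrow> v + 0" by (intro tendsto_intros)
  then show ?thesis using const_le_tendsto_banach_lattice e(2) by force
qed

text \<open>Limits along a directed relation \<open>R\<close> only have to be tested on \<open>R\<close>-increasing sequences.\<close>

lemma directed_limit_exists:
  fixes J :: "'i \<Rightarrow> 'e::banach"
  assumes ne: "D \<noteq> {}"
    and trans: "\<And>p q s. R p q \<Longrightarrow> R q s \<Longrightarrow> R p s"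
    and directed: "\<And>p q. p \<in> D \<Longrightarrow> q \<in> D \<Longrightarrow> \<exists>s\<in>D. R p s \<and> R q s"
    and conv: "\<And>u. (\<And>n. u n \<in> D) \<Longrightarrow> (\<And>n::nat. R (u n) (u (Suc n))) \<Longrightarrow> convergent (\<lambda>n. J (u n))"
  shows "\<exists>l. \<forall>\<epsilon>>0. \<exists>p\<in>D. \<forall>q\<in>D. R p q \<longrightarrow> norm (J q - l) \<le> \<epsilon>"
proof -
  \<comment> \<open>If this Cauchy property fails at \<epsilon>, iterating \<open>g\<close> yields
    an \<open>R\<close>-increasing sequence whose consecutive values differ by more than \<epsilon>,
    against \<open>conv\<close>.\<close>
  have cauchy: "\<exists>p\<in>D. \<forall>q\<in>D. R p q \<longrightarrow> norm (J q - J p) \<le> \<epsilon>" if "\<epsilon> > 0" for \<epsilon>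
  proof (rule ccontr)
    assume "\<not> ?thesis"
    then have "\<forall>p\<in>D. \<exists>q\<in>D. R p q \<and> \<epsilon> < norm (J q - J p)" by (auto simp: not_le)
    then obtain g where g: "\<And>p. p \<in> D \<Longrightarrow> g p \<in> D \<and> R p (g p) \<and> \<epsilon> < norm (J (g p) - J p)"
      by metis
    obtain p where p: "p \<in> D" using ne by auto
    define u where "u n = (g ^^ n) p" for n
    have u: "u n \<in> D" for n by (induction n) (use p g in \<open>auto simp: u_def\<close>)
    have "convergent (\<lambda>n. J (u n))"
      using conv[of u] u g by (simp add: u_def)
    then have "Cauchy (\<lambda>n. J (u n))" by (rule convergent_Cauchy)
    then obtain N where "\<forall>m\<ge>N. \<forall>n\<ge>N. norm (J (u m) - J (u n)) < \<epsilon>"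
      using \<open>\<epsilon> > 0\<close> by (metis CauchyD)
    then have "norm (J (u (Suc N)) - J (u N)) < \<epsilon>" by simp
    moreover have "\<epsilon> < norm (J (u (Suc N)) - J (u N))" using g[OF u[of N]] by (simp add: u_def)
    ultimately show False by simp
  qed
  define \<delta> where "\<delta> n = inverse (real (Suc n))" for n
  have "\<exists>p\<in>D. \<forall>q\<in>D. R p q \<longrightarrow> norm (J q - J p) \<le> \<delta> n" for n
    by (rule cauchy) (simp add: \<delta>_def)
  then obtain p where p: "\<And>n. p n \<in> D" "\<And>n q. q \<in> D \<Longrightarrow> R (p n) q \<Longrightarrow> norm (J q - J (p n)) \<le> \<delta> n"
    by metis
  \<comment> \<open>One \<open>R\<close>-increasing sequence beyond every \<open>p n\<close>, so
    that its limit \<open>l\<close> serves all \<epsilon>. Reflexivity of \<open>R\<close> is not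
    assumed, hence \<open>directed\<close> is called even to go beyond the single index
    \<open>p 0\<close>.\<close>
  have "\<exists>u. \<forall>n. (u n \<in> D \<and> R (p n) (u n)) \<and> R (u n) (u (Suc n))"
  proof (rule dependent_nat_choice)
    show "\<exists>x. x \<in> D \<and> R (p 0) x" using directed[OF p(1)[of 0] p(1)[of 0]] by blast
    show "\<exists>y. (y \<in> D \<and> R (p (Suc n)) y) \<and> R x y" if "x \<in> D \<and> R (p n) x" for x n
      using that p(1)[of "Suc n"] directed by blast
  qed
  then obtain u where u: "\<And>n. u n \<in> D" "\<And>n. R (p n) (u n)" "\<And>n. R (u n) (u (Suc n))" by blast
  then obtain l where l: "(\<lambda>n. J (u n)) \<longlonglongrightarrow> l" using conv[of u] by (auto simp: convergent_def)
  have "\<exists>p\<in>D. \<forall>q\<in>D. R p q \<longrightarrow> norm (J q - l) \<le> \<epsilon>" if "\<epsilon> > 0" for \<epsilon>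
  proof -
    have "eventually (\<lambda>n. \<delta> n < \<epsilon> / 3) sequentially"
      unfolding \<delta>_def using \<open>\<epsilon> > 0\<close> by (intro order_tendstoD[OF LIMSEQ_inverse_real_of_nat]) simp
    moreover have "eventually (\<lambda>n. dist (J (u n)) l < \<epsilon> / 3) sequentially"
      using \<open>\<epsilon> > 0\<close> by (intro tendstoD[OF l]) simp
    ultimately obtain n where n: "\<delta> n < \<epsilon> / 3" "dist (J (u n)) l < \<epsilon> / 3"
      using eventually_happens'[OF sequentially_bot] eventually_conj by blast
    have "norm (J q - l) \<le> \<epsilon>" if "q \<in> D" "R (u n) q" for q
    proof -
      have "norm (J q - J (p n)) \<le> \<delta> n" "norm (J (u n) - J (p n)) \<le> \<delta> n"
        using that u trans[of "p n" "u n" q] p(2)[of _ n] by auto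
      then show ?thesis using n unfolding dist_norm
        using norm_triangle_ineq[of "J q - J (p n)" "- (J (u n) - J (p n)) + (J (u n) - l)"]
          norm_triangle_ineq[of "- (J (u n) - J (p n))" "J (u n) - l"]
        by (simp add: norm_minus_commute)
    qed
    then show ?thesis using u(1)[of n] by blast
  qed
  then show ?thesis by blast
qed

lemma incseq_bounded_convergent:
  fixes x :: "nat \<Rightarrow> 'e::order_continuous_banach_lattice"
  assumes "\<And>n. x n \<le> x (Suc n)" "\<And>n. x n \<le> v"
  shows "convergent x"
proof (rule monotone_order_bounded_convergent)
  have mono: "x m \<le> x n" if "m \<le> n" for m n by (rule lift_Suc_mono_le[of x, OF assms(1) that])
  then show "(\<forall>m. \<forall>n\<ge>m. x m \<le> x n) \<or> (\<forall>m. \<forall>n\<ge>m. x n \<le> x m)" by blast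
  show "bdd_above (range x)" using assms(2) by (auto simp: bdd_above_def)
  show "bdd_below (range x)" using mono[of 0] by (auto simp: bdd_below_def)
qed

text \<open>Jordan decomposition: \<open>S\<close> sums the moduli of the increments,
  \<open>T\<close> the moduli plus the increments. Both increase, bounded by \<open>v\<close> and
  \<open>v + v\<close>, hence converge, and \<open>x n = x 0 + (T n - S n)\<close>.\<close>

lemma bounded_variation_convergent:
  fixes x :: "nat \<Rightarrow> 'e::order_continuous_banach_lattice"
  assumes var: "\<And>n. (\<Sum>k<n. \<bar>x (Suc k) - x k\<bar>) \<le> v"
  shows "convergent x"
proof -
  define S where "S n = (\<Sum>k<n. \<bar>x (Suc k) - x k\<bar>)" for n
  define T where "T n = (\<Sum>k<n. \<bar>x (Suc k) - x k\<bar> + (x (Suc k) - x k))" for n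
  have S: "convergent S"
    by (rule incseq_bounded_convergent[of _ v]) (use var in \<open>auto simp: S_def\<close>)
  have "0 \<le> \<bar>x (Suc n) - x n\<bar> + (x (Suc n) - x n)" for n
  proof -
    have "0 - (x (Suc n) - x n) \<le> \<bar>x (Suc n) - x n\<bar>" by (subst diff_0, rule abs_ge_minus_self)
    then show ?thesis by (simp only: diff_le_eq)
  qed
  moreover have "T n \<le> v + v" for n
  proof -
    have "T n \<le> (\<Sum>k<n. \<bar>x (Suc k) - x k\<bar> + \<bar>x (Suc k) - x k\<bar>)"
      unfolding T_def by (intro sum_mono add_left_mono abs_ge_self)
    also have "\<dots> \<le> v + v"
      unfolding sum.distrib by (intro add_mono var)
    finally show ?thesis .
  qed
  ultimately have T: "convergent T"
    by (intro incseq_bounded_convergent[of T "v + v"]) (simp_all only: T_def sum.lessThan_Suc le_add_same_cancel1)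
  have "T n - S n = x n - x 0" for n
    unfolding T_def S_def sum.distrib sum_lessThan_telescope by (rule add_diff_cancel_left')
  then have x: "x 0 + (T n - S n) = x n" for n by simp
  have "convergent (\<lambda>n. x 0 + (T n - S n))"
    by (intro convergent_add convergent_diff convergent_const S T)
  then show ?thesis by (simp only: x)
qed

text \<open>Order continuity of the norm makes \<open>'e\<close> Dedekind complete: the suprema of
  finite subsets form an upward directed net, its increasing sequences converge, and the limit of
  the net is the least upper bound.\<close>

lemma bounded_above_isLub:
  fixes S :: "'e::order_continuous_banach_lattice set"
  assumes ne: "S \<noteq> {}" and bdd: "\<And>x. x \<in> S \<Longrightarrow> x \<le> v"
  shows "\<exists>l. isLub UNIV S l"
proof -
  define D where "D = {F. finite F \<and> F \<noteq> {} \<and> F \<subseteq> S}"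
  have "\<exists>l. \<forall>\<epsilon>>0. \<exists>p\<in>D. \<forall>q\<in>D. p \<subseteq> q \<longrightarrow> norm (Sup_fin q - l) \<le> \<epsilon>"
  proof (rule directed_limit_exists)
    show "D \<noteq> {}" using ne by (auto simp: D_def)
    show "\<exists>s\<in>D. p \<subseteq> s \<and> q \<subseteq> s" if "p \<in> D" "q \<in> D" for p q
      using that by (intro bexI[of _ "p \<union> q"]) (auto simp: D_def)
    show "convergent (\<lambda>n. Sup_fin (u n))" if "\<And>n. u n \<in> D" "\<And>n. u n \<subseteq> u (Suc n)" for u :: "nat \<Rightarrow> 'e set"
    proof (rule incseq_bounded_convergent)
      have u: "finite (u n)" "u n \<noteq> {}" "u n \<subseteq> S" for n using that(1)[of n] by (simp_all add: D_def)
      show "Sup_fin (u n) \<le> Sup_fin (u (Suc n))" for n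
        by (rule Sup_fin.subset_imp[OF that(2)[of n] u(2)[of n] u(1)[of "Suc n"]])
      show "Sup_fin (u n) \<le> v" for n
        by (rule Sup_fin.boundedI[OF u(1)[of n] u(2)[of n]], rule bdd, rule subsetD[OF u(3)[of n]])
    qed
  qed auto
  then obtain l where l: "\<And>\<epsilon>. \<epsilon> > 0 \<Longrightarrow> \<exists>p\<in>D. \<forall>q\<in>D. p \<subseteq> q \<longrightarrow> norm (Sup_fin q - l) \<le> \<epsilon>" by blast
  have upper: "x \<le> l" if "x \<in> S" for x
  proof (rule le_of_norm_error)
    fix \<epsilon> :: real assume "\<epsilon> > 0"
    then obtain p where p: "p \<in> D" "\<forall>q\<in>D. p \<subseteq> q \<longrightarrow> norm (Sup_fin q - l) \<le> \<epsilon>" using l by blast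
    \<comment> \<open>Adding \<open>x\<close> to \<open>p\<close> stays beyond \<open>p\<close>, so
      the finite supremum is within \<epsilon> of \<open>l\<close> and also dominates
      \<open>x\<close>.\<close>
    have "insert x p \<in> D" using p(1) that by (auto simp: D_def)
    moreover from this have "x \<le> Sup_fin (insert x p)" by (intro Sup_fin.coboundedI) (auto simp: D_def)
    ultimately show "\<exists>e. norm e \<le> \<epsilon> \<and> x \<le> l + e"
      using p(2) by (intro exI[of _ "Sup_fin (insert x p) - l"]) auto
  qed
  have least: "l \<le> w" if "\<And>x. x \<in> S \<Longrightarrow> x \<le> w" for w
  proof (rule le_of_norm_error)
    fix \<epsilon> :: real assume "\<epsilon> > 0"
    then obtain p where p: "p \<in> D" "norm (Sup_fin p - l) \<le> \<epsilon>" using l by blast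
    have "Sup_fin p \<le> w" using p(1) that by (intro Sup_fin.boundedI) (auto simp: D_def)
    then show "\<exists>e. norm e \<le> \<epsilon> \<and> l \<le> w + e"
      using p(2) by (intro exI[of _ "l - Sup_fin p"]) (auto simp: norm_minus_commute algebra_simps)
  qed
  from upper least show ?thesis
    by (metis isLubI2 isUb_UNIV_I setgeI isUbD mem_Collect_eq)
qed

section \<open>Ramps and level sets\<close>

definition ramp :: "real \<Rightarrow> real \<Rightarrow> real \<Rightarrow> real" where
  "ramp a b s = max 0 (min 1 ((s - a) / (b - a)))"

lemma ramp_bounds: "0 \<le> ramp a b s" "ramp a b s \<le> 1"
  by (auto simp: ramp_def)

lemma ramp_eq_0: "a < b \<Longrightarrow> s \<le> a \<Longrightarrow> ramp a b s = 0"
  by (auto simp: ramp_def divide_le_0_iff)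

lemma ramp_eq_1: "a < b \<Longrightarrow> b \<le> s \<Longrightarrow> ramp a b s = 1"
  by (auto simp: ramp_def)

lemma ramp_mono: "a < b \<Longrightarrow> s \<le> t \<Longrightarrow> ramp a b s \<le> ramp a b t"
  unfolding ramp_def by (intro max.mono min.mono divide_right_mono) auto

text \<open>Where the ramp of the higher interval is positive, the ramp of the lower one has already
  reached 1.\<close>

lemma ramp_le_ramp:
  assumes "c < d" "d \<le> a" "a < b"
  shows "ramp a b s \<le> ramp c d s"
  using assms ramp_bounds[of c d s] ramp_bounds[of a b s] ramp_eq_0[of a b s] ramp_eq_1[of c d s]
  by (cases "s \<le> a") auto

lemma continuous_ramp: "a < b \<Longrightarrow> continuous_on UNIV (ramp a b)"
  unfolding ramp_def by (intro continuous_intros) auto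

text \<open>Links the increments of truncations to functions with values in [0, 1], on which the
  variation of \<open>I\<close> is controlled.\<close>

lemma min_diff_eq_ramp: "a < b \<Longrightarrow> min s b - min s a = (b - a) * ramp a b s"
  using ramp_eq_0[of a b s] ramp_eq_1[of a b s]
  by (cases "s \<le> a"; cases "b \<le> s") (simp_all add: ramp_def)

lemma continuous_map_comp_real:
  assumes "continuous_map X euclideanreal f" "continuous_on UNIV \<phi>"
  shows "continuous_map X euclideanreal (\<lambda>x. \<phi> (f x) :: real)"
  using continuous_map_compose[OF assms(1), of euclideanreal \<phi>] assms(2) by (simp add: o_def)

section \<open>Compactness and level sets\<close>

text \<open>If no \<open>A n\<close> fits into \<open>U\<close>, the sets \<open>A n - U\<close> are
  nonempty, closed and decreasing, and compactness gives a point of the intersection outside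
  \<open>U\<close>.\<close>

lemma decseq_closedin_subset_openin:
  assumes "compact_space X" "openin X U"
    and A: "\<And>n. closedin X (A n)" "decseq A" "(\<Inter>n. A n) \<subseteq> U"
  shows "\<exists>n::nat. A n \<subseteq> U"
proof (rule ccontr)
  assume "\<not> ?thesis"
  then have "(\<Inter>n. A n - U) \<noteq> {}"
  proof (intro compact_space_imp_nest[of X])
    show "decseq (\<lambda>n. A n - U)" using A(2) by (force simp: decseq_def)
  qed (use assms in \<open>auto intro: closedin_diff\<close>)
  then show False using A(3) by auto
qed

lemma closedin_upper_level:
  assumes "continuous_map X euclideanreal f"
  shows "closedin X {x \<in> topspace X. f x \<ge> t}"
  using closedin_continuous_map_preimage[OF assms, of "{t..}"] by simp

lemma openin_upper_level:
  assumes "continuous_map X euclideanreal f"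
  shows "openin X {x \<in> topspace X. f x > t}"
  using openin_continuous_map_preimage[OF assms, of "{t<..}"] by simp

text \<open>The closed level sets for \<open>t - 1/(n + 1)\<close> decrease to the one for
  \<open>t\<close>, so one of them already lies in \<open>U\<close>.\<close>

lemma upper_level_subset_openin:
  assumes "compact_space X" "openin X U" "continuous_map X euclideanreal f"
    and sub: "{x \<in> topspace X. f x \<ge> t} \<subseteq> U"
  shows "\<exists>\<delta>>0. {x \<in> topspace X. f x \<ge> t - \<delta>} \<subseteq> U"
proof -
  define A where "A n = {x \<in> topspace X. f x \<ge> t - inverse (real (Suc n))}" for n
  have "\<exists>n. A n \<subseteq> U"
  proof (rule decseq_closedin_subset_openin[OF assms(1,2)])
    show "closedin X (A n)" for n unfolding A_def by (rule closedin_upper_level[OF assms(3)])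
    have "inverse (real (Suc n)) \<le> inverse (real (Suc m))" if "m \<le> n" for m n
      using that by (intro le_imp_inverse_le) auto
    then show "decseq A" unfolding decseq_def A_def by (smt (verit) Collect_mono)
    have "f x \<ge> t" if "\<And>n. f x \<ge> t - inverse (real (Suc n))" for x
      using LIMSEQ_le_const2[OF tendsto_diff[OF tendsto_const LIMSEQ_inverse_real_of_nat]] that by force
    then show "(\<Inter>n. A n) \<subseteq> U" using sub by (auto simp: A_def)
  qed
  then obtain n where "A n \<subseteq> U" by blast
  then show ?thesis unfolding A_def by (intro exI[of _ "inverse (real (Suc n))"]) simp
qed

text \<open>Brings constants, truncations and ramps into the normal form of
  \<open>cont_space\<close>, which requires the value 0 outside \<open>topspace X\<close>.\<close>

definition ext0 :: "'x topology \<Rightarrow> ('x \<Rightarrow> real) \<Rightarrow> 'x \<Rightarrow> real" where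
  "ext0 X h x = (if x \<in> topspace X then h x else 0)"

lemma ext0_in_cont_space: "continuous_map X euclideanreal h \<Longrightarrow> ext0 X h \<in> cont_space X"
  unfolding cont_space_def by (auto simp: ext0_def intro: continuous_map_eq[of X euclideanreal h])

lemma ext0_cont_space: "f \<in> cont_space X \<Longrightarrow> ext0 X f = f"
  by (auto simp: cont_space_def ext0_def fun_eq_iff)

lemma cont_space_continuous_map: "f \<in> cont_space X \<Longrightarrow> continuous_map X euclideanreal f"
  by (simp add: cont_space_def)

lemma upper_setsE:
  assumes "A \<in> upper_sets X"
  obtains f t where "f \<in> cont_space X" "A = {x \<in> topspace X. f x \<ge> t}"
  using assms by (auto simp: upper_sets_def)

lemma upper_setsI: "f \<in> cont_space X \<Longrightarrow> {x \<in> topspace X. f x \<ge> t} \<in> upper_sets X"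
  by (auto simp: upper_sets_def)

lemma closedin_upper_sets: "A \<in> upper_sets X \<Longrightarrow> closedin X A"
  by (auto elim!: upper_setsE intro!: closedin_upper_level cont_space_continuous_map)

text \<open>Cauchy's functional equation on the half-line. Subtracting
  \<open>c *\<^sub>R \<phi> 1\<close> leaves an additive \<psi> that vanishes at natural numbers, so
  its bound on [0, 1] holds everywhere; by \<open>mult\<close> a nonzero value would have unbounded
  multiples.\<close>

lemma linear_of_additive_bounded:
  fixes \<phi> :: "real \<Rightarrow> 'e::real_normed_vector"
  assumes add: "\<And>c d. 0 \<le> c \<Longrightarrow> 0 \<le> d \<Longrightarrow> \<phi> (c + d) = \<phi> c + \<phi> d"
    and bound: "\<And>c. 0 \<le> c \<Longrightarrow> c \<le> 1 \<Longrightarrow> norm (\<phi> c) \<le> K"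
    and c: "0 \<le> c"
  shows "\<phi> c = c *\<^sub>R \<phi> 1"
proof -
  define \<psi> where "\<psi> c = \<phi> c - c *\<^sub>R \<phi> 1" for c
  have add': "\<psi> (c + d) = \<psi> c + \<psi> d" if "0 \<le> c" "0 \<le> d" for c d
    using that by (simp add: \<psi>_def add scaleR_add_left)
  have mult: "\<psi> (real n * c) = real n *\<^sub>R \<psi> c" if "0 \<le> c" for n c
  proof (induction n)
    case 0
    show ?case using add'[of 0 0] by simp
  next
    case (Suc n)
    then show ?case using add'[of "real n * c" c] that by (simp add: algebra_simps)
  qed
  have bound': "norm (\<psi> c) \<le> 2 * K" if "0 \<le> c" for c
  proof -
    define d where "d = c - real (nat \<lfloor>c\<rfloor>)"
    have d: "0 \<le> d" "d \<le> 1" "c = real (nat \<lfloor>c\<rfloor>) + d" using that unfolding d_def by linarith+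
    have "\<psi> (real (nat \<lfloor>c\<rfloor>)) = 0" using mult[of 1 "nat \<lfloor>c\<rfloor>"] by (simp add: \<psi>_def)
    then have "\<psi> c = \<psi> d" using add'[of "real (nat \<lfloor>c\<rfloor>)" d] d by (metis add_0 of_nat_0_le_iff)
    also have "norm (\<psi> d) \<le> norm (\<phi> d) + norm (d *\<^sub>R \<phi> 1)"
      unfolding \<psi>_def by (rule norm_triangle_ineq4)
    also have "norm (d *\<^sub>R \<phi> 1) \<le> 1 * norm (\<phi> 1)"
      using d by (simp add: mult_left_le_one_le)
    finally show ?thesis using bound[of d] bound[of 1] d by simp
  qed
  have "\<psi> c = 0"
  proof (rule ccontr)
    assume "\<psi> c \<noteq> 0"
    then obtain n where "2 * K < real n * norm (\<psi> c)"
      using reals_Archimedean3[of "norm (\<psi> c)"] by auto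
    also have "\<dots> = norm (\<psi> (real n * c))" by (simp add: mult[OF c])
    also have "\<dots> \<le> 2 * K" by (rule bound') (use c in simp)
    finally show False by simp
  qed
  then show ?thesis by (simp add: \<psi>_def)
qed

section \<open>Comonotonic additive operators of bounded variation\<close>

locale comonotonic_bv_operator =
  fixes X :: "'x topology" and I :: "('x \<Rightarrow> real) \<Rightarrow> 'e::order_continuous_banach_lattice"
  assumes compact: "compact_space X"
    and additive: "comonotonic_additive X I"
    and bounded_variation: "operator_bounded_variation X I"
begin

text \<open>Evaluates \<open>I\<close> on the restriction of an arbitrary function to
  \<open>X\<close>, so that formulas such as \<open>ramp a b (f x)\<close> can be used whatever
  their values outside \<open>topspace X\<close>.\<close>

definition J :: "('x \<Rightarrow> real) \<Rightarrow> 'e" where "J h = I (ext0 X h)"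

lemma J_cong: "(\<And>x. x \<in> topspace X \<Longrightarrow> g x = h x) \<Longrightarrow> J g = J h"
  unfolding J_def by (intro arg_cong[where f=I]) (auto simp: ext0_def)

lemma J_cont_space: "f \<in> cont_space X \<Longrightarrow> J f = I f"
  by (simp add: J_def ext0_cont_space)

lemma J_add:
  assumes "continuous_map X euclideanreal g" "continuous_map X euclideanreal h"
    and "\<And>s t. s \<in> topspace X \<Longrightarrow> t \<in> topspace X \<Longrightarrow> (g s - g t) * (h s - h t) \<ge> 0"
  shows "J (\<lambda>x. g x + h x) = J g + J h"
proof -
  have "comonotone X (ext0 X g) (ext0 X h)"
    using assms(3) by (simp add: comonotone_def ext0_def)
  then have "I (\<lambda>x. ext0 X g x + ext0 X h x) = J g + J h"
    using additive assms(1,2) ext0_in_cont_space unfolding comonotonic_additive_def J_def by blast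
  moreover have "(\<lambda>x. ext0 X g x + ext0 X h x) = ext0 X (\<lambda>x. g x + h x)"
    by (auto simp: ext0_def)
  ultimately show ?thesis by (simp add: J_def)
qed

text \<open>Increasing functions of one and the same \<open>f\<close> are comonotone, since both
  follow the order of the values of \<open>f\<close>.\<close>

lemma J_add_comp:
  assumes f: "continuous_map X euclideanreal f" and "continuous_on UNIV \<phi>" "continuous_on UNIV \<psi>"
    and "mono \<phi>" "mono \<psi>"
  shows "J (\<lambda>x. \<phi> (f x) + \<psi> (f x)) = J (\<lambda>x. \<phi> (f x)) + J (\<lambda>x. \<psi> (f x))"
proof (rule J_add)
  show "(\<phi> (f s) - \<phi> (f t)) * (\<psi> (f s) - \<psi> (f t)) \<ge> 0" for s t
  proof (cases "f s \<le> f t")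
    case True
    then show ?thesis
      using monoD[OF assms(4)] monoD[OF assms(5)] by (intro mult_nonpos_nonpos) simp_all
  next
    case False
    then show ?thesis
      using monoD[OF assms(4), of "f t" "f s"] monoD[OF assms(5), of "f t" "f s"] by simp
  qed
qed (intro continuous_map_comp_real[OF f] assms)+

lemma J_zero: "J (\<lambda>x. 0) = 0"
  using J_add[of "\<lambda>x. 0" "\<lambda>x. 0"] by simp

text \<open>A single vector controlling all chains between the constants 0 and 1. The choice is
  meaningful because bounded variation provides the least upper bound.\<close>

definition variation :: 'e where
  "variation = (SOME v. isLub UNIV (operator_variation_sums X I (ext0 X (\<lambda>x. 0)) (ext0 X (\<lambda>x. 1))) v)"

text \<open>Every chain with values in [0, 1] extends to a chain from 0 to 1, and the added terms
  are nonnegative.\<close>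

lemma sum_variation_le:
  assumes cont: "\<And>k. k \<le> n \<Longrightarrow> continuous_map X euclideanreal (u k)"
    and bounds: "\<And>k x. k \<le> n \<Longrightarrow> x \<in> topspace X \<Longrightarrow> 0 \<le> u k x \<and> u k x \<le> 1"
    and mono: "\<And>k x. k < n \<Longrightarrow> x \<in> topspace X \<Longrightarrow> u k x \<le> u (Suc k) x"
  shows "(\<Sum>k<n. \<bar>J (u (Suc k)) - J (u k)\<bar>) \<le> variation"
proof -
  let ?S = "operator_variation_sums X I (ext0 X (\<lambda>x. 0)) (ext0 X (\<lambda>x. 1))"
  have c01: "ext0 X (\<lambda>x. 0) \<in> cont_space X" "ext0 X (\<lambda>x. 1) \<in> cont_space X"
    by (simp_all add: ext0_in_cont_space)
  moreover have "ext0 X (\<lambda>x. 0) \<le> ext0 X (\<lambda>x. 1)" by (simp add: le_fun_def ext0_def)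
  ultimately have lub: "isLub UNIV ?S variation"
    using bounded_variation unfolding variation_def operator_bounded_variation_def
    by (metis (no_types, lifting) someI_ex)
  \<comment> \<open>The constant 0 is put in front and the constant 1 at the end: \<open>u j\<close>
    gets index \<open>Suc j\<close>, and the chain has \<open>Suc (Suc n)\<close> steps.\<close>
  define h where "h k = (case k of 0 \<Rightarrow> (\<lambda>x. 0) | Suc j \<Rightarrow> if j \<le> n then u j else (\<lambda>x. 1))" for k
  have hc: "ext0 X (h k) \<in> cont_space X" for k
    using cont by (auto simp: h_def split: nat.split intro!: ext0_in_cont_space)
  have hm: "ext0 X (h k) \<le> ext0 X (h (Suc k))" for k
    using bounds mono by (auto simp: h_def ext0_def le_fun_def Suc_le_eq not_le less_Suc_eq_le split: nat.split)
  have "(\<Sum>k=1..Suc (Suc n). \<bar>I (ext0 X (h k)) - I (ext0 X (h (k - 1)))\<bar>) \<in> ?S"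
    unfolding operator_variation_sums_def
  proof (intro CollectI exI conjI)
    show "\<forall>k\<in>{1..Suc (Suc n)}. ext0 X (h (k - 1)) \<le> ext0 X (h k)"
    proof
      fix k assume "k \<in> {1..Suc (Suc n)}"
      then show "ext0 X (h (k - 1)) \<le> ext0 X (h k)" using hm[of "k - 1"] by simp
    qed
  qed (auto simp: hc, auto simp: h_def)
  note le = isLubD2[OF lub this]
  have "(\<Sum>k<n. \<bar>J (u (Suc k)) - J (u k)\<bar>) = (\<Sum>k<n. \<bar>J (h (Suc (Suc k))) - J (h (Suc k))\<bar>)"
  proof (rule sum.cong[OF refl])
    fix k assume "k \<in> {..<n}"
    then have "h (Suc (Suc k)) = u (Suc k)" "h (Suc k) = u k" by (simp_all add: h_def)
    then show "\<bar>J (u (Suc k)) - J (u k)\<bar> = \<bar>J (h (Suc (Suc k))) - J (h (Suc k))\<bar>" by (simp only:)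
  qed
  also have "\<dots> \<le> (\<Sum>k<Suc n. \<bar>J (h (Suc k)) - J (h k)\<bar>)"
    unfolding sum.lessThan_Suc_shift by (simp only: le_add_same_cancel2 abs_ge_zero)
  also have "\<dots> \<le> (\<Sum>k<Suc (Suc n). \<bar>J (h (Suc k)) - J (h k)\<bar>)"
    unfolding sum.lessThan_Suc[of _ "Suc n"] by (simp only: le_add_same_cancel1 abs_ge_zero)
  also have "\<dots> \<le> variation"
    using le by (simp only: One_nat_def sum.atLeast1_atMost_eq J_def diff_Suc_Suc diff_zero)
  finally show ?thesis .
qed

lemma abs_J_le:
  assumes "continuous_map X euclideanreal u" "\<And>x. x \<in> topspace X \<Longrightarrow> 0 \<le> u x \<and> u x \<le> 1"
  shows "\<bar>J u\<bar> \<le> variation"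
proof -
  have "(\<Sum>k<1. \<bar>J ((\<lambda>k. if k = 0 then (\<lambda>x. 0) else u) (Suc k)) - J ((\<lambda>k::nat. if k = 0 then (\<lambda>x. 0) else u) k)\<bar>) \<le> variation"
    by (rule sum_variation_le) (use assms in auto)
  then show ?thesis by (simp add: J_zero)
qed

lemma norm_J_le:
  assumes "continuous_map X euclideanreal u" "\<And>x. x \<in> topspace X \<Longrightarrow> 0 \<le> u x \<and> u x \<le> 1"
  shows "norm (J u) \<le> norm variation"
  by (rule norm_le_of_abs_le[OF abs_J_le]) (use assms in auto)

lemma J_incseq_convergent:
  assumes "\<And>n. continuous_map X euclideanreal (u n)"
    and "\<And>n x. x \<in> topspace X \<Longrightarrow> 0 \<le> u n x \<and> u n x \<le> 1"
    and "\<And>n x. x \<in> topspace X \<Longrightarrow> u n x \<le> u (Suc n) x"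
  shows "convergent (\<lambda>n. J (u n))"
  by (rule bounded_variation_convergent, rule sum_variation_le) (use assms in auto)

text \<open>Each finite piece of the sequence, read backwards, is an increasing chain, and moduli of
  increments do not see the direction.\<close>

lemma J_decseq_convergent:
  assumes "\<And>n. continuous_map X euclideanreal (u n)"
    and "\<And>n x. x \<in> topspace X \<Longrightarrow> 0 \<le> u n x \<and> u n x \<le> 1"
    and "\<And>n x. x \<in> topspace X \<Longrightarrow> u (Suc n) x \<le> u n x"
  shows "convergent (\<lambda>n. J (u n))"
proof (rule bounded_variation_convergent)
  fix n
  have "(\<Sum>k<n. \<bar>J (u (Suc k)) - J (u k)\<bar>) = (\<Sum>k<n. \<bar>J (u (Suc (n - Suc k))) - J (u (n - Suc k))\<bar>)"
    by (rule sum.nat_diff_reindex[symmetric])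
  also have "\<dots> = (\<Sum>k<n. \<bar>J (u (n - Suc k)) - J (u (n - k))\<bar>)"
    by (intro sum.cong refl) (simp add: Suc_diff_Suc abs_minus_commute)
  also have "\<dots> \<le> variation"
  proof (rule sum_variation_le)
    show "u (n - k) x \<le> u (n - Suc k) x" if "k < n" "x \<in> topspace X" for k x
      using assms(3)[OF that(2), of "n - Suc k"] that(1) by (simp add: Suc_diff_Suc)
  qed (use assms in auto)
  finally show "(\<Sum>k<n. \<bar>J (u (Suc k)) - J (u k)\<bar>) \<le> variation" .
qed

text \<open>Nonnegative multiples of \<open>u\<close> are comonotone, so \<open>J\<close> is
  additive in the factor, and it is bounded for factors in [0, 1]; the functional equation then
  gives linearity.\<close>

lemma J_scale:
  assumes u: "continuous_map X euclideanreal u" "\<And>x. x \<in> topspace X \<Longrightarrow> 0 \<le> u x \<and> u x \<le> 1"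
    and c: "0 \<le> c"
  shows "J (\<lambda>x. c * u x) = c *\<^sub>R J u"
proof -
  have cont: "continuous_map X euclideanreal (\<lambda>x. c * u x)" for c
    using u(1) by (intro continuous_intros)
  have "J (\<lambda>x. c * u x) = c *\<^sub>R J (\<lambda>x. 1 * u x)"
  proof (rule linear_of_additive_bounded[OF _ _ c])
    fix c d :: real assume cd: "0 \<le> c" "0 \<le> d"
    have "J (\<lambda>x. c * u x + d * u x) = J (\<lambda>x. c * u x) + J (\<lambda>x. d * u x)"
    proof (rule J_add[OF cont cont])
      fix s t
      have "(c * u s - c * u t) * (d * u s - d * u t) = c * d * (u s - u t)\<^sup>2"
        by (simp add: power2_eq_square algebra_simps)
      then show "0 \<le> (c * u s - c * u t) * (d * u s - d * u t)" using cd by simp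
    qed
    then show "J (\<lambda>x. (c + d) * u x) = J (\<lambda>x. c * u x) + J (\<lambda>x. d * u x)"
      by (simp add: distrib_right)
  next
    fix c :: real assume "0 \<le> c" "c \<le> 1"
    then show "norm (J (\<lambda>x. c * u x)) \<le> norm variation"
      using u(2) by (intro norm_J_le cont) (auto intro: mult_le_one)
  qed
  then show ?thesis by simp
qed

lemma J_const: "J (\<lambda>x. c) = c *\<^sub>R J (\<lambda>x. 1)"
proof -
  have pos: "J (\<lambda>x. c) = c *\<^sub>R J (\<lambda>x. 1)" if "0 \<le> c" for c
    using J_scale[of "\<lambda>x. 1" c] that by simp
  \<comment> \<open>Constants are comonotone, so opposite constants have opposite values. This
    reduces negative \<open>c\<close> to the previous case.\<close>
  have "J (\<lambda>x. c) + J (\<lambda>x. - c) = 0" for c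
    using J_add[of "\<lambda>x. c" "\<lambda>x. - c"] J_zero by simp
  from this[of c] pos[of c] pos[of "- c"] show ?thesis
    by (cases "0 \<le> c") (auto simp: add_eq_0_iff)
qed

section \<open>Truncations and their increments\<close>

definition truncated :: "('x \<Rightarrow> real) \<Rightarrow> real \<Rightarrow> 'e" where
  "truncated f s = J (\<lambda>x. min (f x) s)"

text \<open>\<open>min f b\<close> is the sum of \<open>min f a\<close> and the layer between
  \<open>a\<close> and \<open>b\<close>; both are increasing functions of \<open>f\<close>, so
  \<open>J\<close> splits over them, and \<open>J_scale\<close> extracts the thickness of the
  layer.\<close>

lemma truncated_diff:
  assumes f: "continuous_map X euclideanreal f" and "a < b"
  shows "truncated f b - truncated f a = (b - a) *\<^sub>R J (\<lambda>x. ramp a b (f x))"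
proof -
  have eq: "min s b = min s a + (b - a) * ramp a b s" for s
    using min_diff_eq_ramp[OF \<open>a < b\<close>, of s] by simp
  have "J (\<lambda>x. min (f x) a + (b - a) * ramp a b (f x)) =
      J (\<lambda>x. min (f x) a) + J (\<lambda>x. (b - a) * ramp a b (f x))"
  proof (rule J_add_comp[OF f])
    show "mono (\<lambda>s. (b - a) * ramp a b s)"
      using \<open>a < b\<close> by (intro monoI mult_left_mono ramp_mono) auto
  qed (auto intro!: continuous_intros continuous_ramp \<open>a < b\<close> monoI)
  then have "truncated f b = truncated f a + J (\<lambda>x. (b - a) * ramp a b (f x))"
    by (simp only: truncated_def eq)
  moreover have "J (\<lambda>x. (b - a) * ramp a b (f x)) = (b - a) *\<^sub>R J (\<lambda>x. ramp a b (f x))"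
    using \<open>a < b\<close> f
    by (intro J_scale) (auto intro: continuous_map_comp_real continuous_ramp simp: ramp_bounds)
  ultimately show ?thesis by simp
qed

text \<open>All difference quotients are values of \<open>J\<close> at functions with values in
  [0, 1]. This supplies the continuity of the truncations in the level.\<close>

lemma truncated_lipschitz:
  assumes f: "continuous_map X euclideanreal f"
  shows "(norm variation)-lipschitz_on UNIV (truncated f)"
proof (rule lipschitz_onI)
  have *: "norm (truncated f b - truncated f a) \<le> norm variation * (b - a)" if "a < b" for a b
  proof -
    have "norm (J (\<lambda>x. ramp a b (f x))) \<le> norm variation"
      using that f by (intro norm_J_le) (auto intro: continuous_map_comp_real continuous_ramp simp: ramp_bounds)
    then show ?thesis using that by (simp add: truncated_diff[OF f that] mult.commute mult_right_mono)
  qed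
  show "dist (truncated f a) (truncated f b) \<le> norm variation * dist a b" for a b
    using *[of a b] *[of b a]
    by (cases a b rule: linorder_cases) (auto simp: dist_norm norm_minus_commute)
qed simp

end

section \<open>The capacity of an operator\<close>

context comonotonic_bv_operator
begin

text \<open>Asking for the value 1 on an open neighbourhood, and not just on \<open>A\<close>, lets
  a function chosen for an intersection of a decreasing sequence serve the late members of the
  sequence too.\<close>

definition nbhd_functions :: "'x set \<Rightarrow> ('x \<Rightarrow> real) set" where
  "nbhd_functions A = {u. continuous_map X euclideanreal u \<and> (\<forall>x\<in>topspace X. 0 \<le> u x \<and> u x \<le> 1) \<and>
    (\<exists>U. openin X U \<and> A \<subseteq> U \<and> (\<forall>x\<in>U. u x = 1))}"

lemma nbhd_functionsI:
  assumes "continuous_map X euclideanreal u" "\<And>x. x \<in> topspace X \<Longrightarrow> 0 \<le> u x \<and> u x \<le> 1"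
    and "openin X U" "A \<subseteq> U" "\<And>x. x \<in> U \<Longrightarrow> u x = 1"
  shows "u \<in> nbhd_functions A"
  using assms unfolding nbhd_functions_def by blast

lemma nbhd_functionsD:
  assumes "u \<in> nbhd_functions A"
  shows "continuous_map X euclideanreal u" "x \<in> topspace X \<Longrightarrow> 0 \<le> u x \<and> u x \<le> 1"
    "\<exists>U. openin X U \<and> A \<subseteq> U \<and> (\<forall>x\<in>U. u x = 1)"
  using assms by (simp_all add: nbhd_functions_def)

lemma nbhd_functions_antimono: "A \<subseteq> B \<Longrightarrow> nbhd_functions B \<subseteq> nbhd_functions A"
  unfolding nbhd_functions_def by blast

lemma nbhd_functions_min:
  assumes u: "u \<in> nbhd_functions A" and v: "v \<in> nbhd_functions A"
  shows "(\<lambda>x. min (u x) (v x)) \<in> nbhd_functions A"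
proof -
  obtain U V where "openin X U" "A \<subseteq> U" "\<forall>x\<in>U. u x = 1" "openin X V" "A \<subseteq> V" "\<forall>x\<in>V. v x = 1"
    using nbhd_functionsD(3)[OF u] nbhd_functionsD(3)[OF v] by blast
  then show ?thesis
    using nbhd_functionsD(1,2)[OF u] nbhd_functionsD(1,2)[OF v]
    by (intro nbhd_functionsI[of _ "U \<inter> V"] continuous_map_real_min openin_Int) (auto simp: min_def)
qed

lemma one_in_nbhd_functions: "A \<subseteq> topspace X \<Longrightarrow> (\<lambda>x. 1) \<in> nbhd_functions A"
  by (rule nbhd_functionsI[of _ "topspace X"]) auto

text \<open>The limit of \<open>J\<close> along the downward directed family of
  \<open>nbhd_functions A\<close>. It is a norm limit rather than an infimum because
  \<open>J\<close> need not be monotone.\<close>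

definition capacity :: "'x set \<Rightarrow> 'e" where
  "capacity A = (SOME l. \<forall>\<epsilon>>0. \<exists>p\<in>nbhd_functions A. \<forall>q\<in>nbhd_functions A.
    (\<forall>x\<in>topspace X. q x \<le> p x) \<longrightarrow> norm (J q - l) \<le> \<epsilon>)"

lemma capacity_approx:
  assumes "A \<subseteq> topspace X" "\<epsilon> > 0"
  obtains p where "p \<in> nbhd_functions A"
    and "\<And>q. q \<in> nbhd_functions A \<Longrightarrow> (\<And>x. x \<in> topspace X \<Longrightarrow> q x \<le> p x) \<Longrightarrow> norm (J q - capacity A) \<le> \<epsilon>"
proof -
  have "\<exists>l. \<forall>\<epsilon>>0. \<exists>p\<in>nbhd_functions A. \<forall>q\<in>nbhd_functions A.
      (\<forall>x\<in>topspace X. q x \<le> p x) \<longrightarrow> norm (J q - l) \<le> \<epsilon>"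
  \<comment> \<open>The direction is the reversed pointwise order on \<open>topspace X\<close>, so
    its increasing sequences are decreasing sequences of functions and
    \<open>J_decseq_convergent\<close> applies.\<close>
  proof (rule directed_limit_exists)
    show "nbhd_functions A \<noteq> {}" using one_in_nbhd_functions assms(1) by blast
    show "\<forall>x\<in>topspace X. s x \<le> p x"
      if "\<forall>x\<in>topspace X. q x \<le> p x" "\<forall>x\<in>topspace X. s x \<le> q x" for p q s :: "'x \<Rightarrow> real"
      using that by force
    show "\<exists>s\<in>nbhd_functions A. (\<forall>x\<in>topspace X. s x \<le> p x) \<and> (\<forall>x\<in>topspace X. s x \<le> q x)"
      if "p \<in> nbhd_functions A" "q \<in> nbhd_functions A" for p q
      using nbhd_functions_min[OF that] by (intro bexI) auto
    show "convergent (\<lambda>n. J (u n))"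
      if "\<And>n. u n \<in> nbhd_functions A" "\<And>n. \<forall>x\<in>topspace X. u (Suc n) x \<le> u n x" for u
      by (rule J_decseq_convergent) (use that nbhd_functionsD(1,2) in blast)+
  qed
  then have "\<forall>\<epsilon>>0. \<exists>p\<in>nbhd_functions A. \<forall>q\<in>nbhd_functions A.
      (\<forall>x\<in>topspace X. q x \<le> p x) \<longrightarrow> norm (J q - capacity A) \<le> \<epsilon>"
    unfolding capacity_def by (rule someI_ex)
  with assms(2) that show ?thesis by blast
qed

lemma capacity_approx_below:
  assumes "A \<subseteq> topspace X" "\<epsilon> > 0" and w: "w \<in> nbhd_functions A"
  obtains p where "p \<in> nbhd_functions A" "\<And>x. x \<in> topspace X \<Longrightarrow> p x \<le> w x" "norm (J p - capacity A) \<le> \<epsilon>"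
proof -
  obtain p where p: "p \<in> nbhd_functions A"
    "\<And>q. q \<in> nbhd_functions A \<Longrightarrow> (\<And>x. x \<in> topspace X \<Longrightarrow> q x \<le> p x) \<Longrightarrow> norm (J q - capacity A) \<le> \<epsilon>"
    using capacity_approx[OF assms(1,2)] by blast
  show ?thesis
    by (rule that[OF nbhd_functions_min[OF p(1) w]], simp, rule p(2)[OF nbhd_functions_min[OF p(1) w]], simp)
qed

text \<open>If functions with value exactly \<open>v\<close> occur below every member of the family,
  the limit along the family can only be \<open>v\<close>.\<close>

lemma capacity_eqI:
  assumes "A \<subseteq> topspace X" and v: "\<And>u. u \<in> nbhd_functions A \<Longrightarrow>
    \<exists>w\<in>nbhd_functions A. (\<forall>x\<in>topspace X. w x \<le> u x) \<and> J w = v"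
  shows "capacity A = v"
proof -
  have "norm (v - capacity A) \<le> 0 + \<epsilon>" if \<epsilon>: "\<epsilon> > 0" for \<epsilon>
  proof -
    obtain p where p: "p \<in> nbhd_functions A" "\<And>q. q \<in> nbhd_functions A \<Longrightarrow>
        (\<And>x. x \<in> topspace X \<Longrightarrow> q x \<le> p x) \<Longrightarrow> norm (J q - capacity A) \<le> \<epsilon>"
      using capacity_approx[OF assms(1) \<epsilon>] by blast
    obtain w where "w \<in> nbhd_functions A" "\<forall>x\<in>topspace X. w x \<le> p x" "J w = v"
      using v[OF p(1)] by blast
    then show ?thesis using p(2)[of w] by simp
  qed
  then have "norm (v - capacity A) \<le> 0" by (rule field_le_epsilon)
  then show ?thesis by simp
qed

lemma capacity_empty: "capacity {} = 0"
proof (rule capacity_eqI)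
  have zero: "(\<lambda>x. 0) \<in> nbhd_functions {}" by (rule nbhd_functionsI[of _ "{}"]) auto
  show "\<exists>w\<in>nbhd_functions {}. (\<forall>x\<in>topspace X. w x \<le> u x) \<and> J w = 0"
    if "u \<in> nbhd_functions {}" for u
    by (rule bexI[OF _ zero]) (simp add: J_zero nbhd_functionsD(2)[OF that])
qed simp

lemma capacity_topspace: "capacity (topspace X) = J (\<lambda>x. 1)"
proof (rule capacity_eqI)
  show "\<exists>w\<in>nbhd_functions (topspace X). (\<forall>x\<in>topspace X. w x \<le> u x) \<and> J w = J (\<lambda>x. 1)"
    if u: "u \<in> nbhd_functions (topspace X)" for u
  proof (rule bexI[OF _ u], intro conjI ballI order_refl J_cong)
    show "u x = 1" if "x \<in> topspace X" for x using nbhd_functionsD(3)[OF u] that by blast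
  qed
qed simp

section \<open>Upper continuity and bounded variation of the capacity\<close>

text \<open>A function \<open>p\<close> good for the intersection equals 1 on an open
  \<open>U\<close>, and by compactness \<open>A n\<close> lies in \<open>U\<close> for large
  \<open>n\<close>. A \<open>q\<close> below \<open>p\<close> that is good for \<open>A n\<close>
  belongs to the family of the intersection as well, so \<open>J q\<close> is close to both
  capacities.\<close>

lemma capacity_upper_continuous: "upper_continuous (upper_sets X) capacity"
  unfolding upper_continuous_def
proof (intro allI impI)
  fix A :: "nat \<Rightarrow> 'x set"
  assume A: "range A \<subseteq> upper_sets X" "decseq A" "(\<Inter>n. A n) \<in> upper_sets X"
  have closed: "closedin X (A n)" for n using A(1) by (intro closedin_upper_sets) auto
  have sub: "A n \<subseteq> topspace X" for n using closed by (rule closedin_subset)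
  have sub': "(\<Inter>n. A n) \<subseteq> topspace X" using sub by blast
  show "(\<lambda>n. capacity (A n)) \<longlonglongrightarrow> capacity (\<Inter>n. A n)"
  proof (rule LIMSEQ_I)
    fix \<epsilon> :: real assume "\<epsilon> > 0"
    then have "\<epsilon> / 3 > 0" by simp
    obtain p where p: "p \<in> nbhd_functions (\<Inter>n. A n)" "\<And>q. q \<in> nbhd_functions (\<Inter>n. A n) \<Longrightarrow>
        (\<And>x. x \<in> topspace X \<Longrightarrow> q x \<le> p x) \<Longrightarrow> norm (J q - capacity (\<Inter>n. A n)) \<le> \<epsilon> / 3"
      using capacity_approx[OF sub' \<open>\<epsilon> / 3 > 0\<close>] by blast
    obtain U where U: "openin X U" "(\<Inter>n. A n) \<subseteq> U" "\<forall>x\<in>U. p x = 1" using nbhd_functionsD(3)[OF p(1)] by blast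
    obtain N where N: "A N \<subseteq> U" using decseq_closedin_subset_openin[OF compact U(1) closed A(2) U(2)] by blast
    have "norm (capacity (A n) - capacity (\<Inter>n. A n)) < \<epsilon>" if "n \<ge> N" for n
    proof -
      have "A n \<subseteq> U" using decseqD[OF A(2) that] N by blast
      then have "p \<in> nbhd_functions (A n)"
        using nbhd_functionsD(1,2)[OF p(1)] U by (intro nbhd_functionsI[of _ U]) auto
      then obtain q where q: "q \<in> nbhd_functions (A n)" "\<And>x. x \<in> topspace X \<Longrightarrow> q x \<le> p x"
          "norm (J q - capacity (A n)) \<le> \<epsilon> / 3"
        using capacity_approx_below[OF sub \<open>\<epsilon> / 3 > 0\<close>] by blast
      have "q \<in> nbhd_functions (\<Inter>n. A n)" using q(1) nbhd_functions_antimono[of "\<Inter>n. A n" "A n"] by blast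
      then have "norm (J q - capacity (\<Inter>n. A n)) \<le> \<epsilon> / 3" using p(2) q(2) by blast
      then show ?thesis
        using q(3) norm_triangle_ineq4[of "J q - capacity (\<Inter>n. A n)" "J q - capacity (A n)"] \<open>\<epsilon> > 0\<close> by simp
    qed
    then show "\<exists>N. \<forall>n\<ge>N. norm (capacity (A n) - capacity (\<Inter>n. A n)) < \<epsilon>" by blast
  qed
qed

text \<open>The approximants are chosen from the largest set downwards, each below its successor;
  \<open>w\<close> is the ceiling that the induction hands down.\<close>

lemma capacity_chain_approx:
  assumes "\<epsilon> > 0" "\<And>k. k \<le> n \<Longrightarrow> A k \<subseteq> topspace X" "\<And>k. k < n \<Longrightarrow> A k \<subseteq> A (Suc k)"
    and "w \<in> nbhd_functions (A n)"
  shows "\<exists>u. (\<forall>k\<le>n. u k \<in> nbhd_functions (A k) \<and> norm (J (u k) - capacity (A k)) \<le> \<epsilon>) \<and>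
    (\<forall>k<n. \<forall>x\<in>topspace X. u k x \<le> u (Suc k) x) \<and> (\<forall>x\<in>topspace X. u n x \<le> w x)"
  using assms(2-4)
proof (induction n arbitrary: w)
  case 0
  then obtain p where "p \<in> nbhd_functions (A 0)" "\<And>x. x \<in> topspace X \<Longrightarrow> p x \<le> w x" "norm (J p - capacity (A 0)) \<le> \<epsilon>"
    using capacity_approx_below[OF 0(1)[OF order_refl] assms(1) 0(3)] by blast
  then show ?case by (intro exI[of _ "\<lambda>k. p"]) simp
next
  case (Suc n)
  obtain p where p: "p \<in> nbhd_functions (A (Suc n))" "\<And>x. x \<in> topspace X \<Longrightarrow> p x \<le> w x" "norm (J p - capacity (A (Suc n))) \<le> \<epsilon>"
    using capacity_approx_below[OF Suc.prems(1)[OF order_refl] assms(1) Suc.prems(3)] by blast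
  have "p \<in> nbhd_functions (A n)"
    using p(1) nbhd_functions_antimono[OF Suc.prems(2)[OF lessI]] by (rule rev_subsetD)
  then obtain u where u: "\<forall>k\<le>n. u k \<in> nbhd_functions (A k) \<and> norm (J (u k) - capacity (A k)) \<le> \<epsilon>"
    "\<forall>k<n. \<forall>x\<in>topspace X. u k x \<le> u (Suc k) x" "\<forall>x\<in>topspace X. u n x \<le> p x"
    using Suc.IH[of p] Suc.prems(1,2) by (metis le_SucI less_SucI)
  show ?case
  proof (intro exI[of _ "u(Suc n := p)"] conjI allI impI)
    fix k assume "k \<le> Suc n"
    then show "(u(Suc n := p)) k \<in> nbhd_functions (A k)" "norm (J ((u(Suc n := p)) k) - capacity (A k)) \<le> \<epsilon>"
      using u(1) p(1,3) by (cases "k = Suc n"; simp)+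
  next
    fix k assume "k < Suc n"
    then show "\<forall>x\<in>topspace X. (u(Suc n := p)) k x \<le> (u(Suc n := p)) (Suc k) x"
      using u(2,3) by (cases "k = n"; simp)
  qed (use p(2) in simp)
qed

text \<open>An increasing chain of functions approximating the capacities has variation at most
  \<open>variation\<close>. The error is collected in vectors of small norm, as the comparison takes
  place in the order of \<open>'e\<close>.\<close>

lemma capacity_variation_le:
  assumes A: "\<And>k. k \<le> n \<Longrightarrow> A k \<subseteq> topspace X" "\<And>k. k < n \<Longrightarrow> A k \<subseteq> A (Suc k)"
  shows "(\<Sum>k<n. \<bar>capacity (A (Suc k)) - capacity (A k)\<bar>) \<le> variation"
proof (rule le_of_norm_error)
  fix \<epsilon> :: real assume "\<epsilon> > 0"
  \<comment> \<open>Each of the \<open>n\<close> increments carries two errors of norm at most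
    \<delta>; \<open>Suc n\<close> avoids division by zero for the empty sum.\<close>
  define \<delta> where "\<delta> = \<epsilon> / (2 * real (Suc n))"
  have \<delta>: "\<delta> > 0" "2 * real n * \<delta> \<le> \<epsilon>" using \<open>\<epsilon> > 0\<close> by (simp_all add: \<delta>_def field_simps)
  obtain u where u: "\<And>k. k \<le> n \<Longrightarrow> u k \<in> nbhd_functions (A k)"
      "\<And>k. k \<le> n \<Longrightarrow> norm (J (u k) - capacity (A k)) \<le> \<delta>"
      "\<And>k x. k < n \<Longrightarrow> x \<in> topspace X \<Longrightarrow> u k x \<le> u (Suc k) x"
    using capacity_chain_approx[OF \<delta>(1) A one_in_nbhd_functions[OF A(1)[OF order_refl]]] by blast
  define e where "e k = \<bar>J (u k) - capacity (A k)\<bar>" for k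
  have e: "norm (e k) \<le> \<delta>" if "k \<le> n" for k using u(2)[OF that] by (simp add: e_def norm_abs_eq)
  have "\<bar>capacity (A (Suc k)) - capacity (A k)\<bar> \<le> \<bar>J (u (Suc k)) - J (u k)\<bar> + (e (Suc k) + e k)" for k
  proof -
    have eq: "capacity (A (Suc k)) - capacity (A k) =
      (J (u (Suc k)) - J (u k)) + (- (J (u (Suc k)) - capacity (A (Suc k))) + (J (u k) - capacity (A k)))"
      by simp
    show ?thesis
      unfolding e_def eq
      by (rule order_trans[OF abs_triangle_ineq], rule add_left_mono,
          rule order_trans[OF abs_triangle_ineq], simp only: abs_minus_cancel order_refl)
  qed
  then have "(\<Sum>k<n. \<bar>capacity (A (Suc k)) - capacity (A k)\<bar>)
      \<le> (\<Sum>k<n. \<bar>J (u (Suc k)) - J (u k)\<bar> + (e (Suc k) + e k))"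
    by (rule sum_mono)
  also have "\<dots> = (\<Sum>k<n. \<bar>J (u (Suc k)) - J (u k)\<bar>) + (\<Sum>k<n. e (Suc k) + e k)"
    by (rule sum.distrib)
  also have "\<dots> \<le> variation + (\<Sum>k<n. e (Suc k) + e k)"
    by (rule add_right_mono, rule sum_variation_le)
      (simp_all only: nbhd_functionsD[OF u(1)] u(3) less_imp_le Suc_leI)
  finally have le: "(\<Sum>k<n. \<bar>capacity (A (Suc k)) - capacity (A k)\<bar>) \<le> variation + (\<Sum>k<n. e (Suc k) + e k)" .
  have "norm (\<Sum>k<n. e (Suc k) + e k) \<le> (\<Sum>k<n. \<delta> + \<delta>)"
    by (intro sum_norm_le norm_triangle_le add_mono e) auto
  also have "\<dots> \<le> \<epsilon>" using \<delta>(2) by (simp add: algebra_simps)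
  finally show "\<exists>e. norm e \<le> \<epsilon> \<and> (\<Sum>k<n. \<bar>capacity (A (Suc k)) - capacity (A k)\<bar>) \<le> variation + e"
    using le by blast
qed

lemma capacity_bounded_variation: "set_bounded_variation (upper_sets X) capacity"
  unfolding set_bounded_variation_def
proof
  show "\<exists>v. isLub UNIV (set_variation_sums (upper_sets X) capacity) v"
  proof (rule bounded_above_isLub)
    \<comment> \<open>The empty set is the level set of the zero function at level 1. It is where
      every chain starts, and the sum of length 0 shows that there are variation sums at
      all.\<close>
    have "{x \<in> topspace X. ext0 X (\<lambda>x. 0) x \<ge> 1} \<in> upper_sets X"
      by (intro upper_setsI ext0_in_cont_space) simp
    then have "{} \<in> upper_sets X" by (simp add: ext0_def cong: conj_cong)
    then have "(\<Sum>k=1..0::nat. \<bar>capacity ((\<lambda>_. {}) k) - capacity ((\<lambda>_. {}) (k - 1))\<bar>) \<in> set_variation_sums (upper_sets X) capacity"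
      unfolding set_variation_sums_def by (intro CollectI exI[of _ "\<lambda>_. {}"] exI[of _ 0]) simp
    then show "set_variation_sums (upper_sets X) capacity \<noteq> {}" by blast
  next
    fix s assume "s \<in> set_variation_sums (upper_sets X) capacity"
    then obtain A and n :: nat where s: "s = (\<Sum>k=1..n. \<bar>capacity (A k) - capacity (A (k - 1))\<bar>)"
      and A: "\<forall>k\<le>n. A k \<in> upper_sets X" "\<forall>k\<in>{1..n}. A (k - 1) \<subseteq> A k"
      unfolding set_variation_sums_def by blast
    have "A k \<subseteq> topspace X" if "k \<le> n" for k
      by (rule closedin_subset[OF closedin_upper_sets]) (use A(1) that in simp)
    moreover have "A k \<subseteq> A (Suc k)" if "k < n" for k using bspec[OF A(2), of "Suc k"] that by simp
    ultimately show "s \<le> variation"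
      unfolding s One_nat_def sum.atLeast1_atMost_eq diff_Suc_Suc diff_zero by (rule capacity_variation_le)
  qed
qed (rule capacity_empty)

section \<open>One-sided limits of ramp values\<close>

text \<open>For \<open>b < t\<close> the ramp is 1 on the open set \<open>{f > b}\<close> around
  \<open>{f \<ge> t}\<close>; for \<open>a\<close> close to \<open>t\<close> it vanishes outside the
  set \<open>U\<close> where \<open>p\<close> is 1. So it belongs to the family and lies below
  \<open>p\<close>.\<close>

lemma ramp_left_limit:
  assumes f: "continuous_map X euclideanreal f" and "\<epsilon> > 0"
  shows "\<exists>\<delta>>0. \<forall>a b. t - \<delta> < a \<longrightarrow> a < b \<longrightarrow> b < t \<longrightarrow>
    norm (J (\<lambda>x. ramp a b (f x)) - capacity {x \<in> topspace X. f x \<ge> t}) \<le> \<epsilon>"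
proof -
  let ?A = "{x \<in> topspace X. f x \<ge> t}"
  have "?A \<subseteq> topspace X" by blast
  then obtain p where p: "p \<in> nbhd_functions ?A" "\<And>q. q \<in> nbhd_functions ?A \<Longrightarrow>
      (\<And>x. x \<in> topspace X \<Longrightarrow> q x \<le> p x) \<Longrightarrow> norm (J q - capacity ?A) \<le> \<epsilon>"
    using capacity_approx[OF _ \<open>\<epsilon> > 0\<close>] by blast
  obtain U where U: "openin X U" "?A \<subseteq> U" "\<forall>x\<in>U. p x = 1" using nbhd_functionsD(3)[OF p(1)] by blast
  obtain \<delta> where \<delta>: "\<delta> > 0" "{x \<in> topspace X. f x \<ge> t - \<delta>} \<subseteq> U"
    using upper_level_subset_openin[OF compact U(1) f U(2)] by blast
  have "norm (J (\<lambda>x. ramp a b (f x)) - capacity ?A) \<le> \<epsilon>" if "t - \<delta> < a" "a < b" "b < t" for a b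
  proof (rule p(2))
    show "(\<lambda>x. ramp a b (f x)) \<in> nbhd_functions ?A"
    proof (rule nbhd_functionsI[of _ "{x \<in> topspace X. f x > b}"])
      show "continuous_map X euclideanreal (\<lambda>x. ramp a b (f x))"
        by (rule continuous_map_comp_real[OF f continuous_ramp[OF \<open>a < b\<close>]])
      show "openin X {x \<in> topspace X. f x > b}" by (rule openin_upper_level[OF f])
    qed (use that ramp_eq_1[of a b] ramp_bounds in auto)
    fix x assume x: "x \<in> topspace X"
    show "ramp a b (f x) \<le> p x"
    proof (cases "f x \<le> a")
      case True
      then show ?thesis using ramp_eq_0[OF \<open>a < b\<close> True] nbhd_functionsD(2)[OF p(1) x] by simp
    next
      case False
      then have "x \<in> U" using \<delta>(2) x that by auto
      then show ?thesis using U(3) ramp_bounds by simp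
    qed
  qed
  with \<delta>(1) show ?thesis by blast
qed

text \<open>Only the existence of the limit matters, not its value. As intervals move left towards
  \<open>t\<close> their ramps increase, so bounded variation gives convergence.\<close>

lemma ramp_right_limit:
  assumes f: "continuous_map X euclideanreal f"
  shows "\<exists>r. \<forall>\<epsilon>>0. \<exists>\<delta>>0. \<forall>a b. t < a \<longrightarrow> a < b \<longrightarrow> b < t + \<delta> \<longrightarrow> norm (J (\<lambda>x. ramp a b (f x)) - r) \<le> \<epsilon>"
proof -
  define D where "D = {(a, b). t < a \<and> a < b}"
  \<comment> \<open>\<open>R p q\<close> says that the interval \<open>q\<close> lies to the left of
    \<open>p\<close>. Requiring \<open>q\<close> to be nondegenerate makes the relation
    transitive.\<close>
  define R where "R p q \<longleftrightarrow> fst q < snd q \<and> snd q \<le> fst p" for p q :: "real \<times> real"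
  define L where "L p = J (\<lambda>x. ramp (fst p) (snd p) (f x))" for p
  have "\<exists>l. \<forall>\<epsilon>>0. \<exists>p\<in>D. \<forall>q\<in>D. R p q \<longrightarrow> norm (L q - l) \<le> \<epsilon>"
  proof (rule directed_limit_exists)
    have "(t + 1, t + 2) \<in> D" by (simp add: D_def)
    then show "D \<noteq> {}" by blast
    show "R p s" if "R p q" "R q s" for p q s using that by (auto simp: R_def)
    show "\<exists>s\<in>D. R p s \<and> R q s" if "p \<in> D" "q \<in> D" for p q
      using that by (intro bexI[of _ "((t + min (fst p) (fst q)) / 2, min (fst p) (fst q))"]) (auto simp: D_def R_def min_def)
    show "convergent (\<lambda>n. L (u n))" if u: "\<And>n. u n \<in> D" "\<And>n. R (u n) (u (Suc n))" for u
      unfolding L_def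
    proof (rule J_incseq_convergent)
      have lt: "fst (u n) < snd (u n)" for n using u(1)[of n] by (auto simp: D_def)
      show "continuous_map X euclideanreal (\<lambda>x. ramp (fst (u n)) (snd (u n)) (f x))" for n
        by (rule continuous_map_comp_real[OF f continuous_ramp[OF lt]])
      show "ramp (fst (u n)) (snd (u n)) (f x) \<le> ramp (fst (u (Suc n))) (snd (u (Suc n))) (f x)" for n x
        using u(2)[of n] lt by (intro ramp_le_ramp) (auto simp: R_def)
    qed (simp add: ramp_bounds)
  qed
  then obtain r where r: "\<And>\<epsilon>. \<epsilon> > 0 \<Longrightarrow> \<exists>p\<in>D. \<forall>q\<in>D. R p q \<longrightarrow> norm (L q - r) \<le> \<epsilon>" by blast
  have "\<exists>\<delta>>0. \<forall>a b. t < a \<longrightarrow> a < b \<longrightarrow> b < t + \<delta> \<longrightarrow> norm (J (\<lambda>x. ramp a b (f x)) - r) \<le> \<epsilon>" if \<epsilon>: "\<epsilon> > 0" for \<epsilon>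
  proof -
    obtain p where p: "p \<in> D" "\<And>q. q \<in> D \<Longrightarrow> R p q \<Longrightarrow> norm (L q - r) \<le> \<epsilon>" using r[OF \<epsilon>] by blast
    have "norm (L (a, b) - r) \<le> \<epsilon>" if "t < a" "a < b" "b < t + (fst p - t)" for a b
      using that by (intro p(2)) (auto simp: D_def R_def)
    then show ?thesis using p(1) by (intro exI[of _ "fst p - t"]) (auto simp: D_def L_def)
  qed
  then show ?thesis by blast
qed

end

section \<open>Strong Bochner integrals of left derivatives\<close>

lemma simple_bochner_integral_indicator:
  assumes A: "A \<in> sets M" "emeasure M A \<noteq> \<infinity>"
  shows "Bochner_Integration.simple_bochner_integrable M (\<lambda>x. indicator A x *\<^sub>R c)"
    and "Bochner_Integration.simple_bochner_integral M (\<lambda>x. indicator A x *\<^sub>R c) = measure M A *\<^sub>R c"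
proof -
  have g: "simple_function M (indicator A :: _ \<Rightarrow> real)" using A(1) by (rule simple_function_indicator)
  have Asub: "A \<subseteq> space M" using A(1) by (rule sets.sets_into_space)
  show int: "Bochner_Integration.simple_bochner_integrable M (\<lambda>x. indicator A x *\<^sub>R c)"
  proof
    show "simple_function M (\<lambda>x. indicator A x *\<^sub>R c)"
      by (rule simple_function_compose1[OF g])
    have "{x \<in> space M. indicator A x *\<^sub>R c \<noteq> 0} \<subseteq> A" by (auto simp: indicator_def split: if_splits)
    then have "emeasure M {x \<in> space M. indicator A x *\<^sub>R c \<noteq> 0} \<le> emeasure M A"
      using A(1) by (rule emeasure_mono)
    then show "emeasure M {x \<in> space M. indicator A x *\<^sub>R c \<noteq> 0} \<noteq> \<infinity>"
      using A(2) by (auto simp: top_unique)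
  qed
  have "Bochner_Integration.simple_bochner_integral M (\<lambda>x. indicator A x *\<^sub>R c) =
      (\<Sum>y\<in>(indicator A :: _ \<Rightarrow> real) ` space M. measure M {x \<in> space M. indicator A x = y} *\<^sub>R (y *\<^sub>R c))"
    by (rule simple_bochner_integral_partition[OF int g]) simp_all
  \<comment> \<open>The indicator may miss the value 0 or 1 on \<open>space M\<close>; the term of a
    missing value has measure 0.\<close>
  also have "\<dots> = (\<Sum>y\<in>{0, 1::real}. measure M {x \<in> space M. indicator A x = y} *\<^sub>R (y *\<^sub>R c))"
  proof (rule sum.mono_neutral_left)
    show "(indicator A :: _ \<Rightarrow> real) ` space M \<subseteq> {0, 1}" by (auto simp: indicator_def)
    show "\<forall>y\<in>{0, 1} - indicator A ` space M. measure M {x \<in> space M. indicator A x = y} *\<^sub>R (y *\<^sub>R c) = 0"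
    proof
      fix y :: real assume "y \<in> {0, 1} - indicator A ` space M"
      then have "{x \<in> space M. indicator A x = y} = {}" by blast
      then show "measure M {x \<in> space M. indicator A x = y} *\<^sub>R (y *\<^sub>R c) = 0" by (simp only: measure_empty scaleR_zero_left)
    qed
  qed simp
  also have "{x \<in> space M. indicator A x = (1::real)} = A"
    using Asub by (auto simp: indicator_def split: if_splits)
  then have "(\<Sum>y\<in>{0, 1::real}. measure M {x \<in> space M. indicator A x = y} *\<^sub>R (y *\<^sub>R c)) = measure M A *\<^sub>R c"
    by simp
  finally show "Bochner_Integration.simple_bochner_integral M (\<lambda>x. indicator A x *\<^sub>R c) = measure M A *\<^sub>R c" .
qed

text \<open>Taking \<epsilon> as \<open>1/(n + 1)\<close>, uniform closeness gives almost everywhere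
  convergence, and since the error lives on the set \<open>B\<close> of finite measure it gives
  convergence in mean.\<close>

lemma has_strong_bochner_integralI:
  fixes F :: "'a \<Rightarrow> 'e::banach"
  assumes B: "B \<in> sets M" "emeasure M B \<noteq> \<infinity>"
    and approx: "\<And>\<epsilon>. \<epsilon> > 0 \<Longrightarrow> \<exists>s. Bochner_Integration.simple_bochner_integrable M s \<and>
      (AE x in M. norm (F x - s x) \<le> \<epsilon> * indicator B x) \<and> norm (Bochner_Integration.simple_bochner_integral M s - v) \<le> \<epsilon> * C"
  shows "has_strong_bochner_integral M F v"
proof -
  define \<delta> where "\<delta> n = inverse (real (Suc n))" for n
  have \<delta>: "\<delta> n > 0" for n by (simp add: \<delta>_def)
  have \<delta>0: "\<delta> \<longlonglongrightarrow> 0" unfolding \<delta>_def by (rule LIMSEQ_inverse_real_of_nat)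
  obtain s where s: "\<And>n. Bochner_Integration.simple_bochner_integrable M (s n)"
      "\<And>n. AE x in M. norm (F x - s n x) \<le> \<delta> n * indicator B x"
      "\<And>n. norm (Bochner_Integration.simple_bochner_integral M (s n) - v) \<le> \<delta> n * C"
    using approx[OF \<delta>] by metis
  have simple: "simple_function M (s n)" for n
    using s(1)[of n] by (auto elim: simple_bochner_integrable.cases)
  have "AE x in M. \<forall>n. norm (F x - s n x) \<le> \<delta> n * indicator B x"
    using s(2) by (simp add: AE_all_countable)
  then have "AE x in M. (\<lambda>n. s n x) \<longlonglongrightarrow> F x"
  proof eventually_elim
    case (elim x)
    have "(\<lambda>n. s n x - F x) \<longlonglongrightarrow> 0"
    proof (rule Lim_null_comparison[OF _ \<delta>0], intro always_eventually allI)
      fix n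
      have "norm (s n x - F x) \<le> \<delta> n * indicator B x" using elim by (simp add: norm_minus_commute)
      also have "\<dots> \<le> \<delta> n" using \<delta>[of n] by (simp add: indicator_def)
      finally show "norm (s n x - F x) \<le> \<delta> n" .
    qed
    then show ?case by (rule LIM_zero_cancel)
  qed
  then have "strongly_measurable M F"
    unfolding strongly_measurable_def using simple by blast
  moreover have "(\<lambda>n. \<integral>\<^sup>+x. norm (F x - s n x) \<partial>M) \<longlonglongrightarrow> 0"
  proof (rule tendsto_sandwich[OF _ _ tendsto_const])
    have "(\<integral>\<^sup>+x. norm (F x - s n x) \<partial>M) \<le> ennreal (\<delta> n * measure M B)" for n
    proof -
      have "(\<integral>\<^sup>+x. norm (F x - s n x) \<partial>M) \<le> (\<integral>\<^sup>+x. ennreal (\<delta> n) * indicator B x \<partial>M)"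
        using s(2)[of n]
      proof (intro nn_integral_mono_AE, eventually_elim)
        case (elim x)
        then show ?case using \<delta>[of n] by (cases "x \<in> B") (simp_all add: ennreal_leI)
      qed
      also have "\<dots> = ennreal (\<delta> n) * emeasure M B" using B(1) by (rule nn_integral_cmult_indicator)
      also have "\<dots> = ennreal (\<delta> n * measure M B)"
        using B(2) \<delta>[of n] by (simp add: emeasure_eq_ennreal_measure ennreal_mult)
      finally show ?thesis .
    qed
    then show "\<forall>\<^sub>F n in sequentially. (\<integral>\<^sup>+x. norm (F x - s n x) \<partial>M) \<le> ennreal (\<delta> n * measure M B)"
      by simp
    have "(\<lambda>n. ennreal (\<delta> n * measure M B)) \<longlonglongrightarrow> ennreal (0 * measure M B)"
      by (intro tendsto_ennrealI tendsto_mult \<delta>0 tendsto_const)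
    then show "(\<lambda>n. ennreal (\<delta> n * measure M B)) \<longlonglongrightarrow> 0" by simp
  qed simp
  moreover have "(\<lambda>n. Bochner_Integration.simple_bochner_integral M (s n)) \<longlonglongrightarrow> v"
  proof (rule LIM_zero_cancel, rule Lim_null_comparison)
    show "\<forall>\<^sub>F n in sequentially. norm (Bochner_Integration.simple_bochner_integral M (s n) - v) \<le> \<delta> n * C" using s(3) by simp
    show "(\<lambda>n. \<delta> n * C) \<longlonglongrightarrow> 0" using tendsto_mult_right[OF \<delta>0, of C] by simp
  qed
  ultimately show ?thesis unfolding has_strong_bochner_integral_def using s(1) by blast
qed

text \<open>Writing the error bound as \<open>max 0 (norm (s x - g x) - h x) + h x\<close> keeps everything below
  measurable, so the measurability of \<open>F\<close> is never needed.\<close>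

lemma has_strong_bochner_integral_norm_diff_le:
  fixes F :: "'a \<Rightarrow> 'e::banach"
  assumes F: "has_strong_bochner_integral M F p"
    and g: "Bochner_Integration.simple_bochner_integrable M g"
    and h: "h \<in> borel_measurable M" "AE x in M. norm (F x - g x) \<le> h x"
    and c: "(\<integral>\<^sup>+x. ennreal (h x) \<partial>M) \<le> ennreal c" "0 \<le> c"
  shows "norm (p - Bochner_Integration.simple_bochner_integral M g) \<le> c"
proof -
  obtain s where s: "\<And>i::nat. Bochner_Integration.simple_bochner_integrable M (s i)"
      "(\<lambda>i. \<integral>\<^sup>+x. norm (F x - s i x) \<partial>M) \<longlonglongrightarrow> 0"
      "(\<lambda>i. Bochner_Integration.simple_bochner_integral M (s i)) \<longlonglongrightarrow> p"
    using F unfolding has_strong_bochner_integral_def by blast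
  have le: "ennreal (norm (Bochner_Integration.simple_bochner_integral M (s i) - Bochner_Integration.simple_bochner_integral M g))
      \<le> (\<integral>\<^sup>+x. norm (F x - s i x) \<partial>M) + ennreal c" for i
  proof -
    define d where "d x = norm (s i x - g x)" for x
    have d: "Bochner_Integration.simple_bochner_integrable M d"
      unfolding d_def by (rule simple_bochner_integrable_compose2[where p="\<lambda>x y. norm (x - y)", OF _ s(1) g]) simp
    have [measurable]: "d \<in> borel_measurable M"
      using d by (auto intro: borel_measurable_simple_function elim: simple_bochner_integrable.cases)
    note h(1)[measurable]
    have "norm (Bochner_Integration.simple_bochner_integral M (s i) - Bochner_Integration.simple_bochner_integral M g)
        = norm (Bochner_Integration.simple_bochner_integral M (\<lambda>x. s i x - g x))"
      by (simp add: simple_bochner_integral_diff[OF s(1) g])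
    also have "\<dots> \<le> Bochner_Integration.simple_bochner_integral M d"
      unfolding d_def
      by (rule simple_bochner_integral_norm_bound, rule simple_bochner_integrable_compose2[where p="\<lambda>x y. x - y", OF _ s(1) g]) simp
    finally have "ennreal (norm (Bochner_Integration.simple_bochner_integral M (s i) - Bochner_Integration.simple_bochner_integral M g))
        \<le> ennreal (Bochner_Integration.simple_bochner_integral M d)" by (rule ennreal_leI)
    also have "\<dots> = (\<integral>\<^sup>+x. ennreal (d x) \<partial>M)"
      by (rule simple_bochner_integral_eq_nn_integral[OF d]) (simp add: d_def)
    also have "\<dots> \<le> (\<integral>\<^sup>+x. ennreal (max 0 (d x - h x)) + ennreal (h x) \<partial>M)"
    proof (intro nn_integral_mono_AE)
      show "AE x in M. ennreal (d x) \<le> ennreal (max 0 (d x - h x)) + ennreal (h x)"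
        using h(2)
      proof eventually_elim
        case (elim x)
        then have "0 \<le> h x" using norm_ge_zero order_trans by blast
        have "ennreal (d x) \<le> ennreal (max 0 (d x - h x) + h x)" by (rule ennreal_leI) simp
        also have "\<dots> = ennreal (max 0 (d x - h x)) + ennreal (h x)"
          by (rule ennreal_plus) (use \<open>0 \<le> h x\<close> in simp_all)
        finally show ?case .
      qed
    qed
    also have "\<dots> = (\<integral>\<^sup>+x. ennreal (max 0 (d x - h x)) \<partial>M) + (\<integral>\<^sup>+x. ennreal (h x) \<partial>M)"
      by (rule nn_integral_add) measurable
    also have "\<dots> \<le> (\<integral>\<^sup>+x. norm (F x - s i x) \<partial>M) + ennreal c"
    proof (intro add_mono c nn_integral_mono_AE)
      show "AE x in M. ennreal (max 0 (d x - h x)) \<le> ennreal (norm (F x - s i x))"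
        using h(2)
      proof eventually_elim
        case (elim x)
        have "d x \<le> norm (F x - s i x) + norm (F x - g x)"
          unfolding d_def using norm_triangle_ineq4[of "F x - g x" "F x - s i x"] by simp
        then show ?case using elim by (intro ennreal_leI) simp
      qed
    qed
    finally show ?thesis .
  qed
  have "ennreal (norm (p - Bochner_Integration.simple_bochner_integral M g)) \<le> 0 + ennreal c"
  proof (rule LIMSEQ_le)
    show "(\<lambda>i. ennreal (norm (Bochner_Integration.simple_bochner_integral M (s i) - Bochner_Integration.simple_bochner_integral M g)))
        \<longlonglongrightarrow> ennreal (norm (p - Bochner_Integration.simple_bochner_integral M g))"
      by (intro tendsto_ennrealI tendsto_norm tendsto_diff s(3) tendsto_const)
    show "(\<lambda>i. (\<integral>\<^sup>+x. norm (F x - s i x) \<partial>M) + ennreal c) \<longlonglongrightarrow> 0 + ennreal c"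
      by (intro tendsto_add s(2) tendsto_const)
  qed (use le in blast)
  then show ?thesis using c(2) by simp
qed

section \<open>Step approximation of a left derivative\<close>

text \<open>Apply the bound to \<open>[a + h, b - h]\<close> and let \<open>h\<close> decrease to 0,
  using continuity.\<close>

lemma increment_bound_closed_interval:
  fixes \<Phi> :: "real \<Rightarrow> 'e::real_normed_vector"
  assumes cont: "continuous_on UNIV \<Phi>"
    and bound: "\<And>a b. l < a \<Longrightarrow> a < b \<Longrightarrow> b < u \<Longrightarrow> norm (\<Phi> b - \<Phi> a - (b - a) *\<^sub>R c) \<le> \<epsilon> * (b - a)"
    and ab: "l \<le> a" "a \<le> b" "b \<le> u"
  shows "norm (\<Phi> b - \<Phi> a - (b - a) *\<^sub>R c) \<le> \<epsilon> * (b - a)"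
proof (cases "a = b")
  case False
  with ab have "a < b" by simp
  define g where "g h = norm (\<Phi> (b - h) - \<Phi> (a + h) - ((b - h) - (a + h)) *\<^sub>R c) - \<epsilon> * ((b - h) - (a + h))" for h
  have "continuous_on UNIV g"
    unfolding g_def
    by (intro continuous_intros continuous_on_compose2[OF cont]) auto
  then have "(g \<longlongrightarrow> g 0) (at_right 0)"
    by (simp add: continuous_on_eq_continuous_within continuous_within filterlim_at_split)
  moreover have "\<forall>\<^sub>F h in at_right 0. g h \<le> 0"
    unfolding eventually_at_right_field
  proof (intro exI[of _ "(b - a) / 2"] conjI allI impI)
    fix h assume "0 < h" "h < (b - a) / 2"
    then show "g h \<le> 0" unfolding g_def using bound[of "a + h" "b - h"] ab by simp
  qed (use \<open>a < b\<close> in simp)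
  ultimately have "g 0 \<le> 0" by (rule tendsto_upperbound) simp
  then show ?thesis by (simp add: g_def)
qed simp

text \<open>On a short interval just left of \<open>t\<close> both \<open>y\<close> and
  \<open>c\<close> approximate the same increment up to \<epsilon> times its length, so they differ
  by at most twice \<epsilon>.\<close>

lemma left_slope_close:
  fixes \<Phi> :: "real \<Rightarrow> 'e::real_normed_vector"
  assumes left: "\<exists>\<delta>>0. \<forall>a b. t - \<delta> < a \<longrightarrow> a < b \<longrightarrow> b < t \<longrightarrow> norm (\<Phi> b - \<Phi> a - (b - a) *\<^sub>R y) \<le> \<epsilon> * (b - a)"
    and bound: "\<And>a b. l < a \<Longrightarrow> a < b \<Longrightarrow> b < t \<Longrightarrow> norm (\<Phi> b - \<Phi> a - (b - a) *\<^sub>R c) \<le> \<epsilon> * (b - a)"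
    and "l < t"
  shows "norm (y - c) \<le> 2 * \<epsilon>"
proof -
  obtain \<delta> where \<delta>: "\<delta> > 0" "\<And>a b. t - \<delta> < a \<Longrightarrow> a < b \<Longrightarrow> b < t \<Longrightarrow> norm (\<Phi> b - \<Phi> a - (b - a) *\<^sub>R y) \<le> \<epsilon> * (b - a)"
    using left by blast
  obtain a where a: "max l (t - \<delta>) < a" "a < t" using dense[of "max l (t - \<delta>)" t] \<open>l < t\<close> \<delta>(1) by auto
  obtain b where b: "a < b" "b < t" using dense[OF a(2)] by blast
  have "(b - a) * norm (y - c) = norm ((b - a) *\<^sub>R (y - c))" using b by simp
  also have "(b - a) *\<^sub>R (y - c) = (\<Phi> b - \<Phi> a - (b - a) *\<^sub>R c) - (\<Phi> b - \<Phi> a - (b - a) *\<^sub>R y)"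
    by (simp add: scaleR_diff_right)
  also have "norm \<dots> \<le> \<epsilon> * (b - a) + \<epsilon> * (b - a)"
    using \<delta>(2)[of a b] bound[of a b] a b by (intro order_trans[OF norm_triangle_ineq4 add_mono]) auto
  finally have "(b - a) * norm (y - c) \<le> (b - a) * (2 * \<epsilon>)" by (simp add: algebra_simps)
  then show ?thesis using b by simp
qed

lemma emeasure_lebesgue_on_Ioc:
  assumes "S \<in> sets lebesgue" "{a<..b} \<subseteq> S" "a \<le> b"
  shows "{a<..b} \<in> sets (lebesgue_on S)" "emeasure (lebesgue_on S) {a<..b} = ennreal (b - a)"
    "measure (lebesgue_on S) {a<..b} = b - a"
proof -
  show "{a<..b} \<in> sets (lebesgue_on S)" using assms by (simp add: sets_restrict_space_iff)
  show e: "emeasure (lebesgue_on S) {a<..b} = ennreal (b - a)"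
    using assms by (simp add: emeasure_restrict_space)
  show "measure (lebesgue_on S) {a<..b} = b - a"
    using e assms(3) by (simp add: measure_def)
qed

text \<open>By bisection it suffices that approximations can be concatenated and exist on short
  intervals around each \<open>x\<close>. There \<open>F\<close> is close to \<open>F x\<close> on
  the left and to the right slope \<open>r\<close> on the right, so two constants suffice.\<close>

lemma left_derivative_step_approx:
  fixes \<Phi> F :: "real \<Rightarrow> 'e::banach"
  assumes S: "S \<in> sets lebesgue" and cont: "continuous_on UNIV \<Phi>"
    and left: "\<And>t \<epsilon>. \<epsilon> > 0 \<Longrightarrow> \<exists>\<delta>>0. \<forall>a b. t - \<delta> < a \<longrightarrow> a < b \<longrightarrow> b < t \<longrightarrow>
      norm (\<Phi> b - \<Phi> a - (b - a) *\<^sub>R F t) \<le> \<epsilon> * (b - a)"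
    and right: "\<And>t. \<exists>r. \<forall>\<epsilon>>0. \<exists>\<delta>>0. \<forall>a b. t < a \<longrightarrow> a < b \<longrightarrow> b < t + \<delta> \<longrightarrow>
      norm (\<Phi> b - \<Phi> a - (b - a) *\<^sub>R r) \<le> \<epsilon> * (b - a)"
    and "\<epsilon> > 0" "l \<le> u" "{l<..u} \<subseteq> S"
  shows "\<exists>s. Bochner_Integration.simple_bochner_integrable (lebesgue_on S) s \<and>
    (\<forall>t. norm (indicator {l<..u} t *\<^sub>R F t - s t) \<le> \<epsilon> * indicator {l<..u} t) \<and>
    norm (Bochner_Integration.simple_bochner_integral (lebesgue_on S) s - (\<Phi> u - \<Phi> l)) \<le> \<epsilon> * (u - l)"
proof -
  define Q where "Q l u s \<longleftrightarrow> Bochner_Integration.simple_bochner_integrable (lebesgue_on S) s \<and>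
    (\<forall>t. norm (indicator {l<..u} t *\<^sub>R F t - s t) \<le> \<epsilon> * indicator {l<..u} t) \<and>
    norm (Bochner_Integration.simple_bochner_integral (lebesgue_on S) s - (\<Phi> u - \<Phi> l)) \<le> \<epsilon> * (u - l)" for l u s
  have "{l<..u} \<subseteq> S \<longrightarrow> (\<exists>s. Q l u s)"
    using \<open>l \<le> u\<close>
  proof (induction rule: Bolzano)
    case (trans a b c)
    show ?case
    proof
      assume "{a<..c} \<subseteq> S"
      then have "{a<..b} \<subseteq> S" "{b<..c} \<subseteq> S" using trans by auto
      then obtain s1 s2 where s: "Q a b s1" "Q b c s2" using trans by blast
      have i: "Bochner_Integration.simple_bochner_integrable (lebesgue_on S) s1" "Bochner_Integration.simple_bochner_integrable (lebesgue_on S) s2"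
        using s by (simp_all add: Q_def)
      have "Q a c (\<lambda>t. s1 t + s2 t)"
        unfolding Q_def
      proof (intro conjI allI)
        show "Bochner_Integration.simple_bochner_integrable (lebesgue_on S) (\<lambda>t. s1 t + s2 t)"
          by (rule simple_bochner_integrable_compose2[where p="\<lambda>x y. x + y", OF _ i]) simp
        fix t
        have ind: "indicator {a<..c} t = (indicator {a<..b} t + indicator {b<..c} t :: real)"
          using trans by (auto simp: indicator_def)
        have "norm (indicator {a<..b} t *\<^sub>R F t - s1 t) \<le> \<epsilon> * indicator {a<..b} t"
            "norm (indicator {b<..c} t *\<^sub>R F t - s2 t) \<le> \<epsilon> * indicator {b<..c} t"
          using s by (simp_all add: Q_def)
        note norm_triangle_mono[OF this]
        then show "norm (indicator {a<..c} t *\<^sub>R F t - (s1 t + s2 t)) \<le> \<epsilon> * indicator {a<..c} t"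
          unfolding ind by (simp add: algebra_simps)
      next
        have "norm (Bochner_Integration.simple_bochner_integral (lebesgue_on S) s1 - (\<Phi> b - \<Phi> a)) \<le> \<epsilon> * (b - a)"
            "norm (Bochner_Integration.simple_bochner_integral (lebesgue_on S) s2 - (\<Phi> c - \<Phi> b)) \<le> \<epsilon> * (c - b)"
          using s by (simp_all add: Q_def)
        note norm_triangle_mono[OF this]
        then show "norm (Bochner_Integration.simple_bochner_integral (lebesgue_on S) (\<lambda>t. s1 t + s2 t) - (\<Phi> c - \<Phi> a)) \<le> \<epsilon> * (c - a)"
          by (simp add: simple_bochner_integral_add[OF i] algebra_simps)
      qed
      then show "\<exists>s. Q a c s" by blast
    qed
  next
    case (local x)
    \<comment> \<open>Half of \<epsilon>, because \<open>left_slope_close\<close> doubles the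
      error.\<close>
    define \<eta> where "\<eta> = \<epsilon> / 2"
    have "\<eta> > 0" using \<open>\<epsilon> > 0\<close> by (simp add: \<eta>_def)
    obtain \<delta>1 where \<delta>1: "\<delta>1 > 0" "\<And>a b. x - \<delta>1 < a \<Longrightarrow> a < b \<Longrightarrow> b < x \<Longrightarrow>
        norm (\<Phi> b - \<Phi> a - (b - a) *\<^sub>R F x) \<le> \<eta> * (b - a)"
      using left[OF \<open>\<eta> > 0\<close>] by blast
    obtain r where "\<forall>\<epsilon>>0. \<exists>\<delta>>0. \<forall>a b. x < a \<longrightarrow> a < b \<longrightarrow> b < x + \<delta> \<longrightarrow>
      norm (\<Phi> b - \<Phi> a - (b - a) *\<^sub>R r) \<le> \<epsilon> * (b - a)"
      using right by blast
    then obtain \<delta>2 where \<delta>2: "\<delta>2 > 0" "\<And>a b. x < a \<Longrightarrow> a < b \<Longrightarrow> b < x + \<delta>2 \<Longrightarrow>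
        norm (\<Phi> b - \<Phi> a - (b - a) *\<^sub>R r) \<le> \<eta> * (b - a)"
      using \<open>\<eta> > 0\<close> by blast
    show ?case
    proof (intro exI[of _ "min \<delta>1 \<delta>2"] conjI allI impI)
      show "min \<delta>1 \<delta>2 > 0" using \<delta>1(1) \<delta>2(1) by simp
      fix a b assume "a \<le> x \<and> x \<le> b \<and> b - a < min \<delta>1 \<delta>2" and sub: "{a<..b} \<subseteq> S"
      then have ab: "a \<le> x" "x \<le> b" "x - \<delta>1 < a" "b < x + \<delta>2" by auto
      have subs: "{a<..x} \<subseteq> S" "{x<..b} \<subseteq> S" using sub ab by auto
      \<comment> \<open>The point \<open>x\<close> belongs to the left piece, where the
        approximation is exact at \<open>x\<close>; \<open>r\<close> need not be close to
        \<open>F x\<close>.\<close>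
      let ?s1 = "\<lambda>t. indicator {a<..x} t *\<^sub>R F x" and ?s2 = "\<lambda>t. indicator {x<..b} t *\<^sub>R r"
      note e1 = emeasure_lebesgue_on_Ioc[OF S subs(1) ab(1)] and e2 = emeasure_lebesgue_on_Ioc[OF S subs(2) ab(2)]
      note i1 = simple_bochner_integral_indicator[OF e1(1), of "F x", unfolded e1, OF ennreal_neq_top[folded infinity_ennreal_def]]
      note i2 = simple_bochner_integral_indicator[OF e2(1), of r, unfolded e2, OF ennreal_neq_top[folded infinity_ennreal_def]]
      have "Q a b (\<lambda>t. ?s1 t + ?s2 t)"
        unfolding Q_def
      proof (intro conjI allI)
        show "Bochner_Integration.simple_bochner_integrable (lebesgue_on S) (\<lambda>t. ?s1 t + ?s2 t)"
          by (rule simple_bochner_integrable_compose2[where p="\<lambda>x y. x + y", OF _ i1(1) i2(1)]) simp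
        fix t
        consider "t \<in> {a<..<x}" | "t = x" "a < x" | "t \<in> {x<..b}" | "t \<notin> {a<..b}" using ab by fastforce
        then show "norm (indicator {a<..b} t *\<^sub>R F t - (?s1 t + ?s2 t)) \<le> \<epsilon> * indicator {a<..b} t"
        proof cases
          case 1
          have "norm (F t - F x) \<le> 2 * \<eta>"
            by (rule left_slope_close[OF left[OF \<open>\<eta> > 0\<close>], where l = "x - \<delta>1"]) (use \<delta>1 1 ab in auto)
          then show ?thesis using 1 ab by (simp add: \<eta>_def)
        next
          case 2
          then show ?thesis using ab \<open>\<epsilon> > 0\<close> by simp
        next
          case 3
          have "norm (F t - r) \<le> 2 * \<eta>"
            by (rule left_slope_close[OF left[OF \<open>\<eta> > 0\<close>], where l = x]) (use \<delta>2 3 ab in auto)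
          then show ?thesis using 3 ab by (simp add: \<eta>_def)
        next
          case 4
          then have "t \<notin> {a<..x}" "t \<notin> {x<..b}" using ab by auto
          then show ?thesis using 4 by simp
        qed
      next
        \<comment> \<open>The slope estimates concern intervals strictly on one side of
          \<open>x\<close>; continuity extends them to intervals ending at \<open>x\<close>.\<close>
        have "norm (\<Phi> x - \<Phi> a - (x - a) *\<^sub>R F x) \<le> \<eta> * (x - a)"
          by (rule increment_bound_closed_interval[OF cont, where l = "x - \<delta>1" and u = x, OF \<delta>1(2)]) (use ab in auto)
        moreover have "norm (\<Phi> b - \<Phi> x - (b - x) *\<^sub>R r) \<le> \<eta> * (b - x)"
          by (rule increment_bound_closed_interval[OF cont, where l = x and u = "x + \<delta>2", OF \<delta>2(2)]) (use ab in auto)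
        ultimately have "norm ((\<Phi> x - \<Phi> a - (x - a) *\<^sub>R F x) + (\<Phi> b - \<Phi> x - (b - x) *\<^sub>R r)) \<le> \<eta> * (x - a) + \<eta> * (b - x)"
          by (rule norm_triangle_mono)
        also have "\<dots> = \<eta> * (b - a)" by (simp add: algebra_simps)
        also have "\<dots> \<le> \<epsilon> * (b - a)" using \<open>\<epsilon> > 0\<close> ab by (intro mult_right_mono) (auto simp: \<eta>_def)
        finally have "norm ((\<Phi> b - \<Phi> a) - ((x - a) *\<^sub>R F x + (b - x) *\<^sub>R r)) \<le> \<epsilon> * (b - a)"
          by (simp add: algebra_simps)
        then show "norm (Bochner_Integration.simple_bochner_integral (lebesgue_on S) (\<lambda>t. ?s1 t + ?s2 t) - (\<Phi> b - \<Phi> a)) \<le> \<epsilon> * (b - a)"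
          unfolding simple_bochner_integral_add[OF i1(1) i2(1)] i1(2) i2(2) by (simp only: norm_minus_commute)
      qed
      then show "\<exists>s. Q a b s" by blast
    qed
  qed
  then show ?thesis using \<open>{l<..u} \<subseteq> S\<close> unfolding Q_def by blast
qed

section \<open>The representation\<close>

lemma AE_lebesgue_on_neq:
  assumes "S \<in> sets lebesgue"
  shows "AE t in lebesgue_on S. t \<noteq> (c::real)"
proof -
  have "AE t in lebesgue. t \<noteq> c" by (rule AE_completion[OF AE_lborel_singleton])
  then show ?thesis using assms by (subst AE_restrict_space_iff) (auto elim: eventually_mono)
qed

lemma ramp_ge_iff:
  assumes "a < b" "0 < s" "s \<le> 1"
  shows "s \<le> ramp a b y \<longleftrightarrow> a + s * (b - a) \<le> y"
proof -
  have "s \<le> (y - a) / (b - a) \<longleftrightarrow> a + s * (b - a) \<le> y"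
    using assms(1) by (simp add: pos_le_divide_eq le_diff_eq add.commute)
  then show ?thesis using assms(2,3) by (simp add: ramp_def le_max_iff_disj)
qed

text \<open>For levels increasing to \<open>t\<close> the level sets decrease to the one at
  \<open>t\<close>, and all of them are in \<open>upper_sets X\<close>.\<close>

lemma upper_continuous_left_limit:
  assumes cont: "upper_continuous (upper_sets X) \<mu>" and f: "f \<in> cont_space X"
  shows "((\<lambda>s. \<mu> {x \<in> topspace X. f x \<ge> s}) \<longlongrightarrow> \<mu> {x \<in> topspace X. f x \<ge> t}) (at_left t)"
proof (rule tendsto_at_left_sequentially[of "t - 1"])
  fix S :: "nat \<Rightarrow> real" assume S: "\<And>n. S n < t" "incseq S" "S \<longlonglongrightarrow> t"
  let ?A = "\<lambda>n. {x \<in> topspace X. f x \<ge> S n}"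
  have Int: "(\<Inter>n. ?A n) = {x \<in> topspace X. f x \<ge> t}"
  proof (intro equalityI subsetI)
    fix x assume "x \<in> (\<Inter>n. ?A n)"
    then have x: "x \<in> topspace X" "\<And>n. S n \<le> f x" by auto
    then show "x \<in> {x \<in> topspace X. f x \<ge> t}" using LIMSEQ_le_const2[OF S(3)] by blast
  next
    fix x assume "x \<in> {x \<in> topspace X. f x \<ge> t}"
    then show "x \<in> (\<Inter>n. ?A n)" using S(1) less_imp_le order_trans by fastforce
  qed
  have "decseq ?A" unfolding decseq_def
  proof (intro allI impI subsetI)
    fix m n x assume "m \<le> n" "x \<in> ?A n"
    then show "x \<in> ?A m" using incseqD[OF S(2), of m n] by simp
  qed
  moreover have "range ?A \<subseteq> upper_sets X" using upper_setsI[OF f] by blast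
  moreover have "(\<Inter>n. ?A n) \<in> upper_sets X" unfolding Int by (rule upper_setsI[OF f])
  ultimately have "(\<lambda>n. \<mu> (?A n)) \<longlonglongrightarrow> \<mu> (\<Inter>n. ?A n)"
    using cont unfolding upper_continuous_def by blast
  then show "(\<lambda>n. \<mu> (?A n)) \<longlonglongrightarrow> \<mu> {x \<in> topspace X. f x \<ge> t}" by (simp only: Int)
qed simp

text \<open>Together with the next lemma this allows passing from the capacity to its restriction to
  \<open>upper_sets X\<close>.\<close>

lemma upper_continuous_cong:
  assumes "\<And>A. A \<in> \<Sigma> \<Longrightarrow> \<mu> A = \<nu> A"
  shows "upper_continuous \<Sigma> \<mu> \<longleftrightarrow> upper_continuous \<Sigma> \<nu>"
proof -
  have "(\<lambda>n. \<mu> (A n)) = (\<lambda>n. \<nu> (A n))" if "range A \<subseteq> \<Sigma>" for A :: "nat \<Rightarrow> _"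
    using assms that by (auto simp: fun_eq_iff)
  then show ?thesis unfolding upper_continuous_def using assms by auto
qed

lemma set_bounded_variation_cong:
  assumes "{} \<in> \<Sigma>" and eq: "\<And>A. A \<in> \<Sigma> \<Longrightarrow> \<mu> A = \<nu> A"
  shows "set_bounded_variation \<Sigma> \<mu> \<longleftrightarrow> set_bounded_variation \<Sigma> \<nu>"
proof -
  have sub: "set_variation_sums \<Sigma> \<mu> \<subseteq> set_variation_sums \<Sigma> \<nu>"
    if eq: "\<And>A. A \<in> \<Sigma> \<Longrightarrow> \<mu> A = \<nu> A" for \<mu> \<nu> :: "'a set \<Rightarrow> 'b"
  proof
    fix s assume "s \<in> set_variation_sums \<Sigma> \<mu>"
    then obtain A and n :: nat where s: "s = (\<Sum>k=1..n. \<bar>\<mu> (A k) - \<mu> (A (k - 1))\<bar>)"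
      and A: "\<forall>k\<le>n. A k \<in> \<Sigma>" "A 0 = {}" "\<forall>k\<in>{1..n}. A (k - 1) \<subseteq> A k"
      unfolding set_variation_sums_def by blast
    have "s = (\<Sum>k=1..n. \<bar>\<nu> (A k) - \<nu> (A (k - 1))\<bar>)"
      unfolding s using A(1) eq by (intro sum.cong) auto
    with A show "s \<in> set_variation_sums \<Sigma> \<nu>" unfolding set_variation_sums_def by blast
  qed
  have "set_variation_sums \<Sigma> \<mu> = set_variation_sums \<Sigma> \<nu>"
    using sub[of \<mu> \<nu>] sub[of \<nu> \<mu>] eq by (simp add: subset_antisym)
  then show ?thesis using assms unfolding set_bounded_variation_def by simp
qed

context comonotonic_bv_operator
begin

definition represents :: "('x set \<Rightarrow> 'e) \<Rightarrow> bool" where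
  "represents \<mu> \<longleftrightarrow> (\<forall>f\<in>cont_space X. \<exists>p q.
      has_strong_bochner_integral (lebesgue_on {0..}) (\<lambda>t. \<mu> {x \<in> topspace X. f x \<ge> t}) p \<and>
      has_strong_bochner_integral (lebesgue_on {..0})
        (\<lambda>t. \<mu> {x \<in> topspace X. f x \<ge> t} - \<mu> (topspace X)) q \<and>
      I f = p + q)"

lemma empty_in_upper_sets: "{} \<in> upper_sets X"
proof -
  have "{x \<in> topspace X. ext0 X (\<lambda>x. 0) x \<ge> 1} \<in> upper_sets X"
    by (intro upper_setsI ext0_in_cont_space) simp
  then show ?thesis by (simp add: ext0_def cong: conj_cong)
qed

lemma topspace_in_upper_sets: "topspace X \<in> upper_sets X"
proof -
  have "{x \<in> topspace X. ext0 X (\<lambda>x. 0) x \<ge> 0} \<in> upper_sets X"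
    by (intro upper_setsI ext0_in_cont_space) simp
  then show ?thesis by (simp add: ext0_def cong: conj_cong)
qed

text \<open>Covers both integrals of the formula: \<open>c\<close> is 0 on the positive half-line
  and the capacity of the whole space on the negative one. The capacity of the level set is the left
  slope of \<open>truncated f\<close>, so step approximation applies.\<close>

lemma has_strong_bochner_integral_capacity:
  assumes f: "continuous_map X euclideanreal f"
    and S: "S \<in> sets lebesgue" "{a<..b} \<subseteq> S" "a \<le> b"
    and G: "AE t in lebesgue_on S. G t = indicator {a<..b} t *\<^sub>R (capacity {x \<in> topspace X. f x \<ge> t} - c)"
  shows "has_strong_bochner_integral (lebesgue_on S) G (truncated f b - truncated f a - (b - a) *\<^sub>R c)"
proof (rule has_strong_bochner_integralI)
  note e = emeasure_lebesgue_on_Ioc[OF S]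
  show "{a<..b} \<in> sets (lebesgue_on S)" by (rule e)
  show "emeasure (lebesgue_on S) {a<..b} \<noteq> \<infinity>" by (simp add: e)
  let ?F = "\<lambda>t. capacity {x \<in> topspace X. f x \<ge> t}"
  let ?c = "\<lambda>t. indicator {a<..b} t *\<^sub>R c"
  have ic: "Bochner_Integration.simple_bochner_integrable (lebesgue_on S) ?c"
    "Bochner_Integration.simple_bochner_integral (lebesgue_on S) ?c = (b - a) *\<^sub>R c"
    by (simp_all add: simple_bochner_integral_indicator[OF e(1)] e)
  have slope: "norm (truncated f b - truncated f a - (b - a) *\<^sub>R y) \<le> \<epsilon> * (b - a)"
    if "a < b" "norm (J (\<lambda>x. ramp a b (f x)) - y) \<le> \<epsilon>" for a b y \<epsilon>
  proof -
    have "truncated f b - truncated f a - (b - a) *\<^sub>R y = (b - a) *\<^sub>R (J (\<lambda>x. ramp a b (f x)) - y)"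
      by (simp only: truncated_diff[OF f \<open>a < b\<close>] scaleR_diff_right)
    then show ?thesis using that by (simp add: mult.commute mult_right_mono)
  qed
  fix \<epsilon> :: real assume "\<epsilon> > 0"
  have "\<exists>s. Bochner_Integration.simple_bochner_integrable (lebesgue_on S) s \<and>
    (\<forall>t. norm (indicator {a<..b} t *\<^sub>R ?F t - s t) \<le> \<epsilon> * indicator {a<..b} t) \<and>
    norm (Bochner_Integration.simple_bochner_integral (lebesgue_on S) s - (truncated f b - truncated f a)) \<le> \<epsilon> * (b - a)"
  proof (rule left_derivative_step_approx[OF S(1) _ _ _ \<open>\<epsilon> > 0\<close> S(3,2)])
    show "continuous_on UNIV (truncated f)"
      by (rule lipschitz_on_continuous_on[OF truncated_lipschitz[OF f]])
    show "\<exists>\<delta>>0. \<forall>a b. t - \<delta> < a \<longrightarrow> a < b \<longrightarrow> b < t \<longrightarrow>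
        norm (truncated f b - truncated f a - (b - a) *\<^sub>R ?F t) \<le> \<epsilon> * (b - a)" if "\<epsilon> > 0" for t \<epsilon>
      using ramp_left_limit[OF f that, of t] slope by blast
    show "\<exists>r. \<forall>\<epsilon>>0. \<exists>\<delta>>0. \<forall>a b. t < a \<longrightarrow> a < b \<longrightarrow> b < t + \<delta> \<longrightarrow>
        norm (truncated f b - truncated f a - (b - a) *\<^sub>R r) \<le> \<epsilon> * (b - a)" for t
      using ramp_right_limit[OF f, of t] slope by meson
  qed
  then obtain s where s: "Bochner_Integration.simple_bochner_integrable (lebesgue_on S) s"
    "\<And>t. norm (indicator {a<..b} t *\<^sub>R ?F t - s t) \<le> \<epsilon> * indicator {a<..b} t"
    "norm (Bochner_Integration.simple_bochner_integral (lebesgue_on S) s - (truncated f b - truncated f a)) \<le> \<epsilon> * (b - a)"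
    by blast
  show "\<exists>s. Bochner_Integration.simple_bochner_integrable (lebesgue_on S) s \<and>
    (AE t in lebesgue_on S. norm (G t - s t) \<le> \<epsilon> * indicator {a<..b} t) \<and>
    norm (Bochner_Integration.simple_bochner_integral (lebesgue_on S) s -
      (truncated f b - truncated f a - (b - a) *\<^sub>R c)) \<le> \<epsilon> * (b - a)"
  proof (intro exI[of _ "\<lambda>t. s t - ?c t"] conjI)
    show "Bochner_Integration.simple_bochner_integrable (lebesgue_on S) (\<lambda>t. s t - ?c t)"
      by (rule simple_bochner_integrable_compose2[where p="\<lambda>x y. x - y", OF _ s(1) ic(1)]) simp
    show "AE t in lebesgue_on S. norm (G t - (s t - ?c t)) \<le> \<epsilon> * indicator {a<..b} t"
      using G
    proof eventually_elim
      case (elim t)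
      have "G t - (s t - ?c t) = indicator {a<..b} t *\<^sub>R ?F t - s t"
        unfolding elim by (simp add: scaleR_diff_right)
      then show ?case using s(2)[of t] by (simp only:)
    qed
    show "norm (Bochner_Integration.simple_bochner_integral (lebesgue_on S) (\<lambda>t. s t - ?c t) -
      (truncated f b - truncated f a - (b - a) *\<^sub>R c)) \<le> \<epsilon> * (b - a)"
      unfolding simple_bochner_integral_diff[OF s(1) ic(1)] ic(2) using s(3) by (simp add: algebra_simps)
  qed
qed

text \<open>With \<open>M\<close> a bound for \<open>\<bar>f\<bar>\<close>, level sets are empty
  above \<open>M\<close> and full from \<open>- M\<close> downwards, so the integrals reduce to
  \<open>{0<..M}\<close> and \<open>{- M<..0}\<close>. The increments telescope from the constant
  \<open>- M\<close> to \<open>f\<close>, and the value at \<open>- M\<close> cancels the subtracted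
  constant.\<close>

lemma represents_capacity: "represents capacity"
  unfolding represents_def
proof
  fix f assume f: "f \<in> cont_space X"
  note cf = cont_space_continuous_map[OF f]
  have "compactin X (topspace X)" using compact by (simp add: compact_space_def)
  then have "compact (f ` topspace X)" using image_compactin[OF _ cf] by auto
  then obtain M where M: "M > 0" "\<And>x. x \<in> topspace X \<Longrightarrow> \<bar>f x\<bar> \<le> M"
    using compact_imp_bounded[of "f ` topspace X"] by (auto simp: bounded_pos)
  have empty: "{x \<in> topspace X. f x \<ge> t} = {}" if "t > M" for t
    using M(2) that by fastforce
  have full: "{x \<in> topspace X. f x \<ge> t} = topspace X" if "t \<le> - M" for t
    using M(2) that by fastforce
  let ?p = "truncated f M - truncated f 0 - (M - 0) *\<^sub>R 0"
  let ?q = "truncated f 0 - truncated f (- M) - (0 - (- M)) *\<^sub>R capacity (topspace X)"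
  \<comment> \<open>Level 0 belongs to the half-line but not to \<open>{0<..M}\<close>; it is
    discarded as a null set.\<close>
  have nonzero: "AE t in lebesgue_on {0..}. t \<noteq> (0::real)" by (rule AE_lebesgue_on_neq) simp
  have p: "has_strong_bochner_integral (lebesgue_on {0..}) (\<lambda>t. capacity {x \<in> topspace X. f x \<ge> t}) ?p"
  proof (rule has_strong_bochner_integral_capacity[OF cf])
    show "AE t in lebesgue_on {0..}. capacity {x \<in> topspace X. f x \<ge> t} =
        indicator {0<..M} t *\<^sub>R (capacity {x \<in> topspace X. f x \<ge> t} - 0)"
      using AE_space nonzero
    proof eventually_elim
      case (elim t)
      show ?case
      proof (cases "t \<le> M")
        case False
        then have "capacity {x \<in> topspace X. f x \<ge> t} = 0" by (simp only: empty not_le capacity_empty)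
        then show ?thesis by simp
      qed (use elim in simp)
    qed
  qed (use M(1) in auto)
  have q: "has_strong_bochner_integral (lebesgue_on {..0})
      (\<lambda>t. capacity {x \<in> topspace X. f x \<ge> t} - capacity (topspace X)) ?q"
  proof (rule has_strong_bochner_integral_capacity[OF cf])
    show "AE t in lebesgue_on {..0}. capacity {x \<in> topspace X. f x \<ge> t} - capacity (topspace X) =
        indicator {- M<..0} t *\<^sub>R (capacity {x \<in> topspace X. f x \<ge> t} - capacity (topspace X))"
    proof (rule AE_I2)
      fix t :: real assume "t \<in> space (lebesgue_on {..0})"
      then show "capacity {x \<in> topspace X. f x \<ge> t} - capacity (topspace X) =
        indicator {- M<..0} t *\<^sub>R (capacity {x \<in> topspace X. f x \<ge> t} - capacity (topspace X))"
        by (cases "t \<le> - M") (simp_all only: full, simp_all)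
    qed
  qed (use M(1) in auto)
  have "truncated f M = J f"
    unfolding truncated_def by (rule J_cong) (use M(2) in \<open>force simp: min_def\<close>)
  then have "truncated f M = I f" by (simp add: J_cont_space[OF f])
  moreover have "truncated f (- M) = J (\<lambda>x. - M)"
    unfolding truncated_def by (rule J_cong) (use M(2) in \<open>force simp: min_def\<close>)
  then have "truncated f (- M) = - (M *\<^sub>R capacity (topspace X))"
    by (simp add: J_const[of "- M"] capacity_topspace)
  ultimately have "I f = ?p + ?q" by simp
  with p q show "\<exists>p q. has_strong_bochner_integral (lebesgue_on {0..}) (\<lambda>t. capacity {x \<in> topspace X. f x \<ge> t}) p \<and>
      has_strong_bochner_integral (lebesgue_on {..0})
        (\<lambda>t. capacity {x \<in> topspace X. f x \<ge> t} - capacity (topspace X)) q \<and> I f = p + q"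
    by blast
qed

section \<open>Uniqueness of the representing set function\<close>

text \<open>The formula is applied to the ramp itself: its levels in \<open>{0<..1}\<close> are the
  levels of \<open>f\<close> in \<open>{a<..b}\<close>, so the integrand is within \<epsilon> of
  \<open>y\<close> over an interval of length 1.\<close>

lemma represents_ramp_close:
  assumes rep: "represents \<mu>" and "\<mu> {} = 0" and f: "f \<in> cont_space X" and "a < b" "0 \<le> \<epsilon>"
    and close: "\<And>s. a < s \<Longrightarrow> s \<le> b \<Longrightarrow> norm (\<mu> {x \<in> topspace X. f x \<ge> s} - y) \<le> \<epsilon>"
  shows "norm (J (\<lambda>x. ramp a b (f x)) - y) \<le> \<epsilon>"
proof -
  define w where "w = ext0 X (\<lambda>x. ramp a b (f x))"
  have w: "w \<in> cont_space X"
    unfolding w_def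
    by (rule ext0_in_cont_space[OF continuous_map_comp_real[OF cont_space_continuous_map[OF f] continuous_ramp[OF \<open>a < b\<close>]]])
  have w_bounds: "0 \<le> w x" "w x \<le> 1" for x by (simp_all add: w_def ext0_def ramp_bounds)
  obtain p q where p: "has_strong_bochner_integral (lebesgue_on {0..}) (\<lambda>t. \<mu> {x \<in> topspace X. w x \<ge> t}) p"
    and q: "has_strong_bochner_integral (lebesgue_on {..0})
        (\<lambda>t. \<mu> {x \<in> topspace X. w x \<ge> t} - \<mu> (topspace X)) q"
    and I: "I w = p + q"
    using rep w unfolding represents_def by blast
  have zero: "Bochner_Integration.simple_bochner_integrable (lebesgue_on {..0::real}) (\<lambda>t. 0 :: 'e)"
    "Bochner_Integration.simple_bochner_integral (lebesgue_on {..0::real}) (\<lambda>t. 0 :: 'e) = 0"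
    using simple_bochner_integral_indicator[of "{}" "lebesgue_on {..0::real}" "0::'e"] by simp_all
  \<comment> \<open>The ramp is nonnegative, so its level sets at \<open>t \<le> 0\<close> are the
    whole space and the second integrand vanishes.\<close>
  have "norm (q - Bochner_Integration.simple_bochner_integral (lebesgue_on {..0::real}) (\<lambda>t. 0)) \<le> 0"
  proof (rule has_strong_bochner_integral_norm_diff_le[OF q zero(1)])
    show "AE t in lebesgue_on {..0}. norm (\<mu> {x \<in> topspace X. w x \<ge> t} - \<mu> (topspace X) - 0) \<le> 0"
    proof (rule AE_I2)
      fix t :: real assume "t \<in> space (lebesgue_on {..0})"
      then have "t \<le> w x" for x using w_bounds(1)[of x] by simp
      then have "{x \<in> topspace X. w x \<ge> t} = topspace X" by blast
      then show "norm (\<mu> {x \<in> topspace X. w x \<ge> t} - \<mu> (topspace X) - 0) \<le> 0" by simp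
    qed
  qed simp_all
  then have "q = 0" using zero(2) by simp
  have S: "{0::real..} \<in> sets lebesgue" "{0<..1} \<subseteq> {0::real..}" "(0::real) \<le> 1" by auto
  note e = emeasure_lebesgue_on_Ioc[OF S]
  have fin: "emeasure (lebesgue_on {0..}) {0<..1::real} \<noteq> \<infinity>"
    unfolding e infinity_ennreal_def by (rule ennreal_neq_top)
  let ?g = "\<lambda>t::real. indicator {0<..1} t *\<^sub>R y"
  have g: "Bochner_Integration.simple_bochner_integrable (lebesgue_on {0..}) ?g"
    "Bochner_Integration.simple_bochner_integral (lebesgue_on {0..}) ?g = y"
    using simple_bochner_integral_indicator[OF e(1) fin, of y] by (simp_all add: e(3))
  have "norm (p - Bochner_Integration.simple_bochner_integral (lebesgue_on {0..}) ?g) \<le> \<epsilon>"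
  proof (rule has_strong_bochner_integral_norm_diff_le[OF p g(1)])
    show "(\<lambda>t::real. \<epsilon> * indicator {0<..1} t) \<in> borel_measurable (lebesgue_on {0..})"
      by (intro borel_measurable_times borel_measurable_const borel_measurable_indicator e(1))
    show "AE t in lebesgue_on {0..}. norm (\<mu> {x \<in> topspace X. w x \<ge> t} - ?g t) \<le> \<epsilon> * indicator {0<..1} t"
      \<comment> \<open>Level 0 must be left out: there the level set is the whole space, whose
        value need not be close to \<open>y\<close>.\<close>
      using AE_space AE_lebesgue_on_neq[OF S(1), of 0]
    proof eventually_elim
      case (elim t)
      show ?case
      proof (cases "t \<le> 1")
        case True
        have "{x \<in> topspace X. w x \<ge> t} = {x \<in> topspace X. f x \<ge> a + t * (b - a)}"
          using elim True ramp_ge_iff[OF \<open>a < b\<close>, of t] by (auto simp: w_def ext0_def)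
        moreover have "norm (\<mu> {x \<in> topspace X. f x \<ge> a + t * (b - a)} - y) \<le> \<epsilon>"
        proof (rule close)
          show "a < a + t * (b - a)" using elim \<open>a < b\<close> by simp
          have "t * (b - a) \<le> 1 * (b - a)" using True \<open>a < b\<close> by (intro mult_right_mono) auto
          then show "a + t * (b - a) \<le> b" by simp
        qed
        ultimately show ?thesis using elim True by simp
      next
        case False
        then have "\<not> t \<le> w x" for x using w_bounds(2)[of x] by linarith
        then have "\<mu> {x \<in> topspace X. w x \<ge> t} = 0" using \<open>\<mu> {} = 0\<close> by simp
        then show ?thesis using False by simp
      qed
    qed
    have "(\<integral>\<^sup>+t. ennreal (\<epsilon> * indicator {0<..1} t) \<partial>lebesgue_on {0::real..})
        = (\<integral>\<^sup>+t. ennreal \<epsilon> * indicator {0<..1} t \<partial>lebesgue_on {0::real..})"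
      by (intro nn_integral_cong) (simp add: indicator_def)
    also have "\<dots> = ennreal \<epsilon> * emeasure (lebesgue_on {0..}) {0<..1::real}"
      by (rule nn_integral_cmult_indicator[OF e(1)])
    finally show "(\<integral>\<^sup>+t. ennreal (\<epsilon> * indicator {0<..1} t) \<partial>lebesgue_on {0::real..}) \<le> ennreal \<epsilon>"
      by (simp add: e)
  qed fact
  then have "norm (p - y) \<le> \<epsilon>" by (simp only: g(2))
  moreover have "J (\<lambda>x. ramp a b (f x)) = p" using I \<open>q = 0\<close> by (simp add: J_def w_def)
  ultimately show ?thesis by simp
qed

text \<open>The intervals lie strictly left of \<open>t\<close> and shrink to it, where left
  continuity keeps the values close. The sequence itself is built from \<open>I\<close> alone, so it
  determines \<mu>.\<close>

lemma represents_ramp_tendsto: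
  assumes rep: "represents \<mu>" and "\<mu> {} = 0" and cont: "upper_continuous (upper_sets X) \<mu>"
    and f: "f \<in> cont_space X"
  shows "(\<lambda>n. J (\<lambda>x. ramp (t - 2 * inverse (real (Suc n))) (t - inverse (real (Suc n))) (f x)))
    \<longlonglongrightarrow> \<mu> {x \<in> topspace X. f x \<ge> t}"
proof (rule LIMSEQ_I)
  fix \<epsilon> :: real assume "\<epsilon> > 0"
  let ?F = "\<lambda>s. \<mu> {x \<in> topspace X. f x \<ge> s}"
  have "\<forall>\<^sub>F s in at_left t. dist (?F s) (?F t) < \<epsilon> / 2"
    using upper_continuous_left_limit[OF cont f] \<open>\<epsilon> > 0\<close> by (intro tendstoD) auto
  then obtain d where d: "d < t" "\<And>s. d < s \<Longrightarrow> s < t \<Longrightarrow> norm (?F s - ?F t) < \<epsilon> / 2"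
    unfolding eventually_at_left_field dist_norm by blast
  have "(\<lambda>n. t - 2 * inverse (real (Suc n))) \<longlonglongrightarrow> t - 2 * 0"
    by (intro tendsto_intros LIMSEQ_inverse_real_of_nat)
  then have "\<forall>\<^sub>F n in sequentially. d < t - 2 * inverse (real (Suc n))"
    using d(1) by (intro order_tendstoD(1)) auto
  then obtain N where N: "\<And>n. n \<ge> N \<Longrightarrow> d < t - 2 * inverse (real (Suc n))"
    unfolding eventually_sequentially by blast
  have "norm (J (\<lambda>x. ramp (t - 2 * inverse (real (Suc n))) (t - inverse (real (Suc n))) (f x)) - ?F t) < \<epsilon>"
    if "n \<ge> N" for n
  proof -
    have pos: "inverse (real (Suc n)) > 0" by simp
    have "norm (J (\<lambda>x. ramp (t - 2 * inverse (real (Suc n))) (t - inverse (real (Suc n))) (f x)) - ?F t) \<le> \<epsilon> / 2"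
    proof (rule represents_ramp_close[OF rep \<open>\<mu> {} = 0\<close> f])
      show "t - 2 * inverse (real (Suc n)) < t - inverse (real (Suc n))" using pos by linarith
      show "0 \<le> \<epsilon> / 2" using \<open>\<epsilon> > 0\<close> by simp
      show "norm (?F s - ?F t) \<le> \<epsilon> / 2"
        if "t - 2 * inverse (real (Suc n)) < s" "s \<le> t - inverse (real (Suc n))" for s
        using d(2)[of s] N[OF \<open>n \<ge> N\<close>] that pos by linarith
    qed
    then show ?thesis using \<open>\<epsilon> > 0\<close> by linarith
  qed
  then show "\<exists>N. \<forall>n\<ge>N. norm (J (\<lambda>x. ramp (t - 2 * inverse (real (Suc n))) (t - inverse (real (Suc n))) (f x)) - ?F t) < \<epsilon>"
    by blast
qed

lemma represents_cong:
  assumes "\<And>A. A \<in> upper_sets X \<Longrightarrow> \<mu> A = \<nu> A"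
  shows "represents \<mu> \<longleftrightarrow> represents \<nu>"
  unfolding represents_def
  by (intro ball_cong refl) (simp add: assms upper_setsI topspace_in_upper_sets)

text \<open>Fixing the values outside \<open>upper_sets X\<close> by extensionality turns uniqueness
  on that lattice into equality of functions. Any candidate and the capacity are limits of the same
  ramp values.\<close>

lemma representing_capacity_exists_unique:
  "\<exists>!\<mu>. \<mu> \<in> extensional (upper_sets X) \<and> upper_continuous (upper_sets X) \<mu> \<and>
    set_bounded_variation (upper_sets X) \<mu> \<and> represents \<mu>"
proof (rule ex1I)
  let ?\<mu> = "restrict capacity (upper_sets X)"
  have eq: "?\<mu> A = capacity A" if "A \<in> upper_sets X" for A using that by simp
  show "?\<mu> \<in> extensional (upper_sets X) \<and> upper_continuous (upper_sets X) ?\<mu> \<and>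
    set_bounded_variation (upper_sets X) ?\<mu> \<and> represents ?\<mu>"
    using capacity_upper_continuous capacity_bounded_variation represents_capacity
    by (simp only: upper_continuous_cong[of _ ?\<mu>, OF eq] represents_cong[of ?\<mu>, OF eq]
        set_bounded_variation_cong[of _ ?\<mu>, OF empty_in_upper_sets eq] restrict_extensional simp_thms)
  fix \<mu> assume \<mu>: "\<mu> \<in> extensional (upper_sets X) \<and> upper_continuous (upper_sets X) \<mu> \<and>
    set_bounded_variation (upper_sets X) \<mu> \<and> represents \<mu>"
  show "\<mu> = ?\<mu>"
  proof (rule extensionalityI[of _ "upper_sets X"])
    fix A assume A: "A \<in> upper_sets X"
    then obtain f t where f: "f \<in> cont_space X" and At: "A = {x \<in> topspace X. f x \<ge> t}" by (rule upper_setsE)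
    have "\<mu> {} = 0" using \<mu> by (simp add: set_bounded_variation_def)
    then have "\<mu> A = capacity A"
      unfolding At using \<mu>
      by (intro LIMSEQ_unique[OF represents_ramp_tendsto[of \<mu>] represents_ramp_tendsto[of capacity]]
          f represents_capacity capacity_empty capacity_upper_continuous) simp_all
    then show "\<mu> A = ?\<mu> A" using A by simp
  qed (use \<mu> in auto)
qed

end

theorem theorem4:
  fixes X :: "'x topology"
    and I :: "('x \<Rightarrow> real) \<Rightarrow> 'e::order_continuous_banach_lattice"
  assumes "compact_space X" and "Hausdorff_space X"
    and "comonotonic_additive X I"
    and "operator_bounded_variation X I"
  shows "\<exists>!\<mu>. \<mu> \<in> extensional (upper_sets X) \<and>
    upper_continuous (upper_sets X) \<mu> \<and>
    set_bounded_variation (upper_sets X) \<mu> \<and>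
    (\<forall>f\<in>cont_space X. \<exists>p q.
      has_strong_bochner_integral (lebesgue_on {0..})
        (\<lambda>t. \<mu> {x \<in> topspace X. f x \<ge> t}) p \<and>
      has_strong_bochner_integral (lebesgue_on {..0})
        (\<lambda>t. \<mu> {x \<in> topspace X. f x \<ge> t} - \<mu> (topspace X)) q \<and>
      I f = p + q)"
proof -
  interpret comonotonic_bv_operator X I by unfold_locales fact+
  show ?thesis using representing_capacity_exists_unique unfolding represents_def .
qed

end
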